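(* Let $D$ be a long clasp diagram with $n$ chords, enumerated by $1,\dots,n$ in the order of their left endpoints along the skeleton, with $\varepsilon_i=\pm1$ the sign of the chord $i$. Define the $n\times n$ matrix $S_D=(s_{ij})$ over $\mathbb{Z}[t,t^{-1}]$ as follows. For each pair $i,j$ of intersecting chords of $D$ with $i$ passing over $j$, put $s_{ij}=t-1$ and $s_{ji}=t^{-1}-1$ if $i<j$, and $s_{ij}=1-t$ and $s_{ji}=1-t^{-1}$ if $i>j$. Put $s_{ii}=-\varepsilon_i$ for all $i$, and let all remaining entries be $0$. Then the Alexander polynomial $\Delta_K(t)$ of the knot $K=K_D$ realizing $D$ satisfies $$\Delta_K(t)=\det S_D,$$ where the Alexander polynomial is considered up to sign and multiplication by powers of $t$.
   Context: Long chord diagrams: a long chord diagram is a finite set of intervals (chords) smoothly embedded into an oriented two-dimensional disk whose boundary carries one marked point; the endpoints of the chords are all distinct and lie on the boundary away from the marked point. The boundary minus the marked point is the skeleton, a line oriented as the boundary of the disk and thought of as going from left to right. Diagrams are considered up to homotopies of chords and displacements of the marked point keeping all endpoints and the marked point distinct; so only the linear order of the endpoints along the skeleton and their pairing matter. Two chords intersect (are linked) if their endpoints interleave along the skeleton. Long clasp diagram: a long chord diagram whose chords are equipped with a total order, called height, and each with a sign $\pm1$. For intersecting chords, "$i$ passes over $j$" means that $i$ has greater height than $j$. A compact clasp diagram (with no marked point) becomes a long one after choosing a base point on its skeleton. Realization $K_D$ of a long clasp diagram $D$: place the disk in the plane $\mathbb{R}^2$ with its standard orientation, sending the marked point to infinity,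 so that the skeleton is a line and the disk is the half-plane to its left. For each chord $c$ with sign $\varepsilon$, replace small arcs of the skeleton around the two endpoints of $c$ by two thin hairpin-shaped fingers running along $c$ from its two endpoints; the tips of the two fingers overlap near the middle of $c$ in exactly two crossings and are hooked together there (each finger is over at one of these crossings and under at the other), in such a way that both crossings have sign $\varepsilon$, i.e. the two strings are linked with linking number $\varepsilon$. Where two chords cross, the fingers following the chord of greater height pass over the fingers following the chord of smaller height. The result is a diagram of a knot $K_D$. *)

theory Defs
  imports
    "HOL-Library.Poly_Mapping"
    "Jordan_Normal_Form.Determinant"
    "Jordan_Normal_Form.DL_Submatrix"
begin

section \<open>Integral Laurent polynomials\<close>

text \<open>The ring of integral Laurent polynomials in one variable is the group ring of the infinite
  cyclic group: finitely supported maps from exponents to coefficients, with convolution.\<close>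

type_synonym laurent = "int \<Rightarrow>\<^sub>0 int"

definition tpow :: "int \<Rightarrow> laurent" where
  "tpow k = Poly_Mapping.single k 1"

abbreviation t :: laurent where "t \<equiv> tpow 1"
abbreviation t_inv :: laurent where "t_inv \<equiv> tpow (- 1)"

definition laurent_equiv :: "laurent \<Rightarrow> laurent \<Rightarrow> bool" (infix "\<doteq>" 50) where
  "p \<doteq> q \<longleftrightarrow> (\<exists>k. p = tpow k * q \<or> p = - (tpow k * q))"


section \<open>Knot diagrams and the Alexander polynomial\<close>

datatype level = Over | Under

text \<open>An oriented knot diagram is recorded by its signed Gauss code: starting from a base point,
  the crossings in the order in which the knot runs through them, each with the information
  whether it is passed on the upper or on the lower strand, together with the signs of the
  crossings. In the Gauss code of a diagram each crossing occurs exactly once on each level.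
  The code is read cyclically.\<close>

record 'c knot_diagram =
  gauss_code :: "('c \<times> level) list"
  crossing_sign :: "'c \<Rightarrow> int"

definition undercrossings :: "'c knot_diagram \<Rightarrow> 'c list" where
  "undercrossings K = map fst (filter (\<lambda>p. snd p = Under) (gauss_code K))"

text \<open>Arcs run from one undercrossing to the next one. They are numbered along the knot; arc 0
  contains the base point, and arc r ends at the undercrossing number r (counted from 0). A diagram
  without crossings has a single arc.\<close>

definition num_arcs :: "'c knot_diagram \<Rightarrow> nat" where
  "num_arcs K = max 1 (length (undercrossings K))"

definition over_arc :: "'c knot_diagram \<Rightarrow> 'c \<Rightarrow> nat" where
  "over_arc K c =
     length (filter (\<lambda>p. snd p = Under) (takeWhile (\<lambda>p. p \<noteq> (c, Over)) (gauss_code K)))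
       mod num_arcs K"

text \<open>Words in the free group on the generators indexed by natural numbers; the letter
  (g, True) is the generator number g, and (g, False) is its inverse.\<close>

type_synonym group_word = "(nat \<times> bool) list"

text \<open>The Wirtinger relator at the undercrossing number r says that the outgoing lower arc is the
  conjugate of the incoming lower arc r by the upper arc, or by its inverse, according to the sign.\<close>

definition wirtinger_relator :: "'c knot_diagram \<Rightarrow> nat \<Rightarrow> group_word" where
  "wirtinger_relator K r =
     (let c = undercrossings K ! r; pos = (crossing_sign K c = 1)
      in [(over_arc K c, pos), (r, True), (over_arc K c, \<not> pos), (Suc r mod num_arcs K, False)])"

text \<open>The Fox derivative of a word with respect to the generator g, followed by the abelianization
  sending every generator to t: the derivative of u v is that of u plus u times that of v.\<close>

fun fox_derivative :: "nat \<Rightarrow> group_word \<Rightarrow> laurent" where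
  "fox_derivative g [] = 0"
| "fox_derivative g ((h, True) # w) = (if h = g then 1 else 0) + t * fox_derivative g w"
| "fox_derivative g ((h, False) # w) = (if h = g then - t_inv else 0) + t_inv * fox_derivative g w"

definition alexander_matrix :: "'c knot_diagram \<Rightarrow> laurent mat" where
  "alexander_matrix K =
     mat (length (undercrossings K)) (num_arcs K)
       (\<lambda>(r, g). fox_derivative g (wirtinger_relator K r))"

definition minors :: "nat \<Rightarrow> 'a :: comm_ring_1 mat \<Rightarrow> 'a set" where
  "minors k A = {det (submatrix A I J) | I J.
     I \<subseteq> {..<dim_row A} \<and> J \<subseteq> {..<dim_col A} \<and> card I = k \<and> card J = k}"

text \<open>The Alexander polynomial is the greatest common divisor of the generators of the first
  elementary ideal; it is determined up to units only, hence a predicate.\<close>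

definition is_alexander_polynomial :: "'c knot_diagram \<Rightarrow> laurent \<Rightarrow> bool" where
  "is_alexander_polynomial K p \<longleftrightarrow>
     (let E = minors (num_arcs K - 1) (alexander_matrix K)
      in (\<forall>m \<in> E. p dvd m) \<and> (\<forall>q. (\<forall>m \<in> E. q dvd m) \<longrightarrow> q dvd p))"


section \<open>Long clasp diagrams\<close>

text \<open>The chords are 0, ..., n - 1. The skeleton is oriented from left to right and its 2 n chord
  endpoints are numbered 0, ..., 2 n - 1 along it. Only the order of the heights matters.\<close>

record clasp_diagram =
  num_chords :: nat
  left_end :: "nat \<Rightarrow> nat"
  right_end :: "nat \<Rightarrow> nat"
  height :: "nat \<Rightarrow> nat"
  chord_sign :: "nat \<Rightarrow> int"

text \<open>Each point 0, ..., 2 n - 1 is the endpoint of exactly one chord (the two images have n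
  elements each), and the chords are enumerated in the order of their left endpoints.\<close>

definition long_clasp_diagram :: "clasp_diagram \<Rightarrow> bool" where
  "long_clasp_diagram D \<longleftrightarrow>
     (let n = num_chords D in
        (\<forall>i<n. left_end D i < right_end D i) \<and>
        strict_mono_on {..<n} (left_end D) \<and>
        inj_on (right_end D) {..<n} \<and>
        left_end D ` {..<n} \<inter> right_end D ` {..<n} = {} \<and>
        left_end D ` {..<n} \<union> right_end D ` {..<n} = {..<2 * n} \<and>
        inj_on (height D) {..<n} \<and>
        (\<forall>i<n. chord_sign D i \<in> {1, - 1}))"

definition intersecting :: "clasp_diagram \<Rightarrow> nat \<Rightarrow> nat \<Rightarrow> bool" where
  "intersecting D i j \<longleftrightarrow>
     left_end D i < left_end D j \<and> left_end D j < right_end D i \<and> right_end D i < right_end D j \<or>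
     left_end D j < left_end D i \<and> left_end D i < right_end D j \<and> right_end D j < right_end D i"

definition passes_over :: "clasp_diagram \<Rightarrow> nat \<Rightarrow> nat \<Rightarrow> bool" where
  "passes_over D i j \<longleftrightarrow> intersecting D i j \<and> height D j < height D i"


section \<open>Realization\<close>

text \<open>
  The skeleton is the horizontal axis, directed to the right, and the disk is the upper half-plane.
  The chord i is drawn as a vertical left leg from its left endpoint, a horizontal bar, and a
  vertical right leg down to its right endpoint; bars of chords with larger numbers are lower.
  Then no crossing lies on a left leg, two disjoint chords do not meet, and for intersecting chords
  i < j the only crossing is that of the right leg of i with the bar of j. The bar of j is crossed,
  from left to right, by the right legs of the chords i < j intersecting j, in the order of
  their right endpoints; the right leg of i is crossed, from top to bottom, by the bars of the
  chords j > i intersecting i, in increasing order of j.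

  The middle of a chord is put at the corner between bar and right leg. So the left finger follows
  the left leg and the bar, the right finger follows the right leg, and they are hooked at the
  corner. Each finger has two strands: the outgoing one runs from the endpoint of the chord
  to the tip, the returning one runs back. As the skeleton is directed to the right, the outgoing
  strand of a left finger is the upper strand along the bar, and the outgoing strand of a right
  finger is the left strand along the right leg.

  Near the clasp, straighten the corner so that the left finger comes from the left and the right
  finger from the right. The two tips intersect in an upper and a lower crossing. The left finger
  passes the upper one first, in direction (1,-1), and then the lower one, in direction (-1,-1); the
  right finger passes the lower one first, in direction (-1,1), and then the upper one, in
  direction (1,1). Hence both crossings are positive if the left finger is over at the upper and
  under at the lower crossing, and both are negative if it is the other way round.
\<close>

datatype strand = Out | Back

datatype clasp_part = Upper | Lower

text \<open>\<open>FingerCrossing i j p q\<close> is the crossing of the strand p of the right finger of i with the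
  strand q of the left finger of j, for intersecting chords i < j.\<close>

datatype crossing =
  FingerCrossing nat nat strand strand
| ClaspCrossing nat clasp_part

fun direction :: "strand \<Rightarrow> int" where
  "direction Out = 1"
| "direction Back = - 1"

text \<open>At a crossing of fingers the right finger of i is directed by (0, d) and the left finger of j
  by (e, 0), where d and e are the directions of the strands. The sign of a crossing is the sign
  of the determinant with columns (direction of the upper strand, direction of the lower strand).\<close>

fun realization_sign :: "clasp_diagram \<Rightarrow> crossing \<Rightarrow> int" where
  "realization_sign D (FingerCrossing i j p q) =
     (if passes_over D i j then - (direction p * direction q) else direction p * direction q)"
| "realization_sign D (ClaspCrossing i u) = chord_sign D i"

definition finger_level :: "clasp_diagram \<Rightarrow> nat \<Rightarrow> nat \<Rightarrow> level" where
  "finger_level D i j = (if passes_over D i j then Over else Under)"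

definition left_clasp_level :: "clasp_diagram \<Rightarrow> nat \<Rightarrow> clasp_part \<Rightarrow> level" where
  "left_clasp_level D i u = (if (u = Upper) = (chord_sign D i = 1) then Over else Under)"

definition right_clasp_level :: "clasp_diagram \<Rightarrow> nat \<Rightarrow> clasp_part \<Rightarrow> level" where
  "right_clasp_level D i u = (if (u = Upper) = (chord_sign D i = 1) then Under else Over)"

definition left_finger :: "clasp_diagram \<Rightarrow> nat \<Rightarrow> (crossing \<times> level) list" where
  "left_finger D j =
     (let is = sort_key (right_end D) (filter (\<lambda>i. intersecting D i j) [0..<j]);
          pass = (\<lambda>i p q. (FingerCrossing i j p q, finger_level D j i));
          hook = (\<lambda>u. (ClaspCrossing j u, left_clasp_level D j u))
      in concat (map (\<lambda>i. [pass i Out Out, pass i Back Out]) is)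
         @ [hook Upper, hook Lower]
         @ concat (map (\<lambda>i. [pass i Back Back, pass i Out Back]) (rev is)))"

definition right_finger :: "clasp_diagram \<Rightarrow> nat \<Rightarrow> (crossing \<times> level) list" where
  "right_finger D i =
     (let js = filter (\<lambda>j. intersecting D i j) [Suc i..<num_chords D];
          pass = (\<lambda>j p q. (FingerCrossing i j p q, finger_level D i j));
          hook = (\<lambda>u. (ClaspCrossing i u, right_clasp_level D i u))
      in concat (map (\<lambda>j. [pass j Out Back, pass j Out Out]) (rev js))
         @ [hook Lower, hook Upper]
         @ concat (map (\<lambda>j. [pass j Back Out, pass j Back Back]) js))"

definition finger_at :: "clasp_diagram \<Rightarrow> nat \<Rightarrow> (crossing \<times> level) list" where
  "finger_at D x =
     (if x \<in> left_end D ` {..<num_chords D}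
      then left_finger D (THE i. i < num_chords D \<and> left_end D i = x)
      else right_finger D (THE i. i < num_chords D \<and> right_end D i = x))"

definition realization :: "clasp_diagram \<Rightarrow> crossing knot_diagram" where
  "realization D =
     \<lparr>gauss_code = concat (map (finger_at D) [0..<2 * num_chords D]),
      crossing_sign = realization_sign D\<rparr>"


section \<open>The matrix of a long clasp diagram\<close>

definition clasp_matrix :: "clasp_diagram \<Rightarrow> laurent mat" where
  "clasp_matrix D = mat (num_chords D) (num_chords D) (\<lambda>(i, j).
     if i = j then - of_int (chord_sign D i)
     else if passes_over D i j then (if i < j then t - 1 else 1 - t)
     else if passes_over D j i then (if j < i then t_inv - 1 else 1 - t_inv)
     else 0)"

end

theory Submission
  imports Defs "HOL-Library.Function_Algebras"
begin

text \<open>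
  Colour the arcs by elements of a module over the Laurent polynomials so that the Wirtinger
  relations hold, \<open>out = u * in + (1 - u) * over\<close> with \<open>u = t\<close> or \<open>t\<inverse>\<close>. The two strands of a
  finger differ by a colour that is constant along the finger, because both strands pass under the
  same pairs of antiparallel strands; a finger that passes under another one is shifted by \<open>\<plusminus>(1 - t)\<close>
  times the difference of the latter. The clasp forces the two fingers of the chord \<open>i\<close> to have
  opposite differences \<open>d i\<close> and \<open>- d i\<close>, so all colours are explicit combinations of
  \<open>d 0, \<dots>, d (n - 1)\<close>, and the only relations left, one per clasp, are
  \<open>- \<epsilon> i * d i + (t\<inverse> - 1) * (Q i - P i - d i) = 0\<close>, where \<open>P i\<close> and \<open>Q i\<close> are the colours with which the
  left and the right finger reach the clasp. These are the columns of the clasp matrix.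

  For the minors this is used twice. Colouring the arcs of the long knot by the standard basis, modulo
  the row span of its Alexander matrix, shows that the determinant of this matrix divides the
  determinant of the clasp matrix; by Laplace expansion along the last arc, so does every common
  divisor of the minors. Letting \<open>d\<close> be the standard basis, modulo the row span of the transposed clasp
  matrix, shows that the determinant of the clasp matrix divides every minor.
\<close>

section \<open>Laurent polynomials\<close>

lemma tpow_mult: "tpow a * tpow b = tpow (a + b)"
  by (simp add: tpow_def mult_single)

lemma tpow_0 [simp]: "tpow 0 = 1"
  by (simp add: tpow_def)

lemma t_mult_t_inv [simp]: "t * t_inv = 1" "t_inv * t = 1" "t * (t_inv * x) = x" "t_inv * (t * x) = x"
  by (simp_all add: tpow_mult mult.assoc [symmetric])

text \<open>The factor \<open>s\<close> lets one proof serve the highest exponents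
  (\<open>s = 1\<close>) and the lowest ones (\<open>s = - 1\<close>). If two exponents add up to
  \<open>A + B\<close>, both bounds must be equalities, so a single product survives in the
  convolution.\<close>

lemma lookup_mult_extremal:
  fixes a b :: laurent
  assumes a: "\<And>k. k \<in> Poly_Mapping.keys a \<Longrightarrow> s * k \<le> s * A"
    and b: "\<And>k. k \<in> Poly_Mapping.keys b \<Longrightarrow> s * k \<le> s * B" and s: "s \<noteq> 0"
  shows "Poly_Mapping.lookup (a * b) (A + B) = Poly_Mapping.lookup a A * Poly_Mapping.lookup b B"
proof -
  have *: "A = l \<and> B = q" 
    if "A + B = l + q" "Poly_Mapping.lookup a l \<noteq> 0" "Poly_Mapping.lookup b q \<noteq> 0" for l q
  proof -
    have "s * l \<le> s * A" "s * q \<le> s * B"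
      using that a b by (auto simp: in_keys_iff)
    moreover have "s * A + s * B = s * l + s * q"
      using that(1) by (metis distrib_left)
    ultimately have "s * A = s * l" "s * B = s * q" by linarith+
    then show ?thesis using s by simp
  qed
  have inner: "Sum_any (\<lambda>q. Poly_Mapping.lookup b q when A + B = l + q) = Poly_Mapping.lookup b (A + B - l)"
    for l
  proof -
    have "Sum_any (\<lambda>q. Poly_Mapping.lookup b q when A + B = l + q) =
        Sum_any (\<lambda>q. Poly_Mapping.lookup b q when q = A + B - l)"
      by (rule Sum_any.cong) (auto simp: when_def)
    then show ?thesis by simp
  qed
  have "Poly_Mapping.lookup (a * b) (A + B) =
    Sum_any (\<lambda>l. Poly_Mapping.lookup a l * Poly_Mapping.lookup b (A + B - l))"
    by (simp add: lookup_mult inner)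
  also have "\<dots> = Sum_any (\<lambda>l. Poly_Mapping.lookup a A * Poly_Mapping.lookup b B when l = A)"
  proof (rule Sum_any.cong)
    fix l
    show "Poly_Mapping.lookup a l * Poly_Mapping.lookup b (A + B - l) =
        (Poly_Mapping.lookup a A * Poly_Mapping.lookup b B when l = A)"
      using *[of l "A + B - l"] by (cases "l = A") auto
  qed
  finally show ?thesis by simp
qed

text \<open>By the extremal coefficients, the largest exponents of \<open>a\<close> and
  \<open>b\<close> add up to 0, and so do the smallest ones. Hence \<open>a\<close> is a monomial,
  and its coefficient is an integer unit.\<close>

lemma laurent_unit:
  fixes a b :: laurent
  assumes ab: "a * b = 1"
  shows "\<exists>k. a = tpow k \<or> a = - tpow k"
proof -
  let ?Ka = "Poly_Mapping.keys a" and ?Kb = "Poly_Mapping.keys b"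
  have ne: "?Ka \<noteq> {}" "?Kb \<noteq> {}" using ab by auto
  have fin: "finite ?Ka" "finite ?Kb" by auto
  have mx: "Max ?Ka \<in> ?Ka" "Max ?Kb \<in> ?Kb" "Min ?Ka \<in> ?Ka" "Min ?Kb \<in> ?Kb"
    using ne fin by auto
  have hi: "Poly_Mapping.lookup (a * b) (Max ?Ka + Max ?Kb) =
      Poly_Mapping.lookup a (Max ?Ka) * Poly_Mapping.lookup b (Max ?Kb)"
    by (rule lookup_mult_extremal[where s = 1]) (use fin in auto)
  have lo: "Poly_Mapping.lookup (a * b) (Min ?Ka + Min ?Kb) =
      Poly_Mapping.lookup a (Min ?Ka) * Poly_Mapping.lookup b (Min ?Kb)"
    by (rule lookup_mult_extremal[where s = "-1"]) (use fin in auto)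
  have z: "Max ?Ka + Max ?Kb = 0" "Min ?Ka + Min ?Kb = 0"
    using hi lo mx unfolding ab by (auto simp: lookup_one when_def in_keys_iff split: if_splits)
  have "Min ?Ka \<le> Max ?Ka" "Min ?Kb \<le> Max ?Kb" using mx fin by auto
  with z have eq: "Min ?Ka = Max ?Ka" by linarith
  define k where "k = Max ?Ka"
  have sub: "x = k" if "x \<in> ?Ka" for x
    using that fin eq unfolding k_def by (metis Max_ge Min_le order_antisym)
  have a: "a = Poly_Mapping.single k (Poly_Mapping.lookup a k)"
  proof (rule poly_mapping_eqI)
    fix x show "Poly_Mapping.lookup a x = Poly_Mapping.lookup (Poly_Mapping.single k (Poly_Mapping.lookup a k)) x"
      using sub[of x] by (cases "x = k") (auto simp: lookup_single when_def in_keys_iff)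
  qed
  have "Poly_Mapping.lookup a k * Poly_Mapping.lookup b (Max ?Kb) = 1"
    using hi z unfolding ab k_def by simp
  then have "Poly_Mapping.lookup a k = 1 \<or> Poly_Mapping.lookup a k = - 1"
    by (metis zmult_eq_1_iff)
  then show ?thesis
    using a by (auto simp: tpow_def single_uminus)
qed

text \<open>The units of the ring are the powers \<open>tpow k\<close> and their negatives, so the
  equivalence is associatedness in an integral domain.\<close>

lemma laurent_equiv_iff_dvd: "p \<doteq> q \<longleftrightarrow> p dvd q \<and> q dvd p"
proof
  assume "p \<doteq> q"
  then obtain k where k: "p = tpow k * q \<or> p = - (tpow k * q)"
    by (auto simp: laurent_equiv_def)
  then have "q = tpow (- k) * p \<or> q = - (tpow (- k) * p)"
    by (auto simp: mult.assoc [symmetric] tpow_mult)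
  with k show "p dvd q \<and> q dvd p"
    by (metis dvd_minus_iff dvd_triv_right)
next
  assume "p dvd q \<and> q dvd p"
  then obtain a b where ab: "q = p * a" "p = q * b" by (metis dvdE)
  show "p \<doteq> q"
  proof (cases "p = 0")
    case True
    with ab show ?thesis by (auto simp: laurent_equiv_def)
  next
    case False
    have "p * (b * a) = p * 1" using ab by (metis mult.assoc mult.commute mult_1_right)
    then have "b * a = 1" using False by (metis mult_left_cancel)
    then obtain k where "b = tpow k \<or> b = - tpow k" using laurent_unit by blast
    then show ?thesis using ab(2) by (auto simp: laurent_equiv_def mult.commute)
  qed
qed

section \<open>Determinants and presentation matrices\<close>

text \<open>A surjection between modules presented by square matrices makes the determinant of the
  target divide that of the source. Here generator \<open>i\<close> of \<open>S\<close> goes to row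
  \<open>i\<close> of \<Delta>: \<open>YA\<close> says that relations are respected,
  \<open>XA\<close> that every generator of \<open>A\<close> is reached modulo the rows of
  \<open>A\<close>.\<close>

lemma det_dvd_of_presentation:
  fixes A :: "'a :: idom mat"
  assumes A: "A \<in> carrier_mat N N" and S: "S \<in> carrier_mat n n"
    and B: "B \<in> carrier_mat N n" and \<Delta>: "\<Delta> \<in> carrier_mat n N"
    and X: "X \<in> carrier_mat N N" and Y: "Y \<in> carrier_mat n N"
    and XA: "X * A = 1\<^sub>m N - B * \<Delta>" and YA: "Y * A = S * \<Delta>"
  shows "det A dvd det S"
proof -
  have "four_block_mat X (- B) Y S * four_block_mat A (0\<^sub>m N n) (0\<^sub>m n N) (1\<^sub>m n) =
      four_block_mat (X * A) (- B) (Y * A) S"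
    using assms by (subst mult_four_block_mat) (auto intro!: cong_four_block_mat)
  also have "\<dots> = four_block_mat (1\<^sub>m N) (- B) (0\<^sub>m n N) S * four_block_mat (1\<^sub>m N) (0\<^sub>m N n) \<Delta> (1\<^sub>m n)"
    using B \<Delta> S unfolding XA YA
    by (subst mult_four_block_mat) (auto intro!: cong_four_block_mat eq_matI simp: uminus_scalar_prod)
  finally have eq: "four_block_mat X (- B) Y S * four_block_mat A (0\<^sub>m N n) (0\<^sub>m n N) (1\<^sub>m n) =
      four_block_mat (1\<^sub>m N) (- B) (0\<^sub>m n N) S * four_block_mat (1\<^sub>m N) (0\<^sub>m N n) \<Delta> (1\<^sub>m n)" .
  have "det (four_block_mat X (- B) Y S) * det A = det S"
    using arg_cong[OF eq, of det] assms
    by (simp add: det_mult[where n = "N + n"] det_four_block_mat_upper_right_zero[where n = N and m = n]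
        det_four_block_mat_lower_left_zero[where n = N and m = n])
  then show ?thesis by (metis dvd_triv_right)
qed

text \<open>The same principle with \<open>M\<close> as the source: row \<open>g\<close> of
  \<open>B\<close> is the colour of generator \<open>g\<close> in the module presented by
  \<open>S\<close>. By \<open>MB\<close> the colours satisfy the relations of \<open>M\<close>, by
  \<open>\<Delta>B\<close> they generate.\<close>

lemma det_dvd_of_colouring:
  fixes M :: "'a :: idom mat"
  assumes M: "M \<in> carrier_mat m m" and S: "S \<in> carrier_mat n n"
    and B: "B \<in> carrier_mat m n" and \<Delta>: "\<Delta> \<in> carrier_mat n m"
    and C: "C \<in> carrier_mat m n" and K: "K \<in> carrier_mat n n"
    and MB: "M * B = C * S" and \<Delta>B: "\<Delta> * B = 1\<^sub>m n + K * S"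
  shows "det S dvd det M"
proof -
  have "four_block_mat M (0\<^sub>m m n) (- \<Delta>) (1\<^sub>m n) * four_block_mat (1\<^sub>m m) B (0\<^sub>m n m) (1\<^sub>m n) =
      four_block_mat M (M * B) (- \<Delta>) (- (\<Delta> * B) + 1\<^sub>m n)"
    using assms by (subst mult_four_block_mat) (auto intro!: cong_four_block_mat)
  also have "\<dots> = four_block_mat M C (- \<Delta>) (- K) * four_block_mat (1\<^sub>m m) (0\<^sub>m m n) (0\<^sub>m n m) S"
    using M C \<Delta> K S unfolding MB \<Delta>B
    by (subst mult_four_block_mat) (auto intro!: cong_four_block_mat eq_matI simp: uminus_scalar_prod)
  finally have eq: "four_block_mat M (0\<^sub>m m n) (- \<Delta>) (1\<^sub>m n) * four_block_mat (1\<^sub>m m) B (0\<^sub>m n m) (1\<^sub>m n)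
      = four_block_mat M C (- \<Delta>) (- K) * four_block_mat (1\<^sub>m m) (0\<^sub>m m n) (0\<^sub>m n m) S" .
  have "det M = det (four_block_mat M C (- \<Delta>) (- K)) * det S"
    using arg_cong[OF eq, of det] assms
    by (simp add: det_mult[where n = "m + n"] det_four_block_mat_upper_right_zero[where n = m and m = n]
        det_four_block_mat_lower_left_zero[where n = m and m = n])
  then show ?thesis by (metis dvd_triv_right)
qed

section \<open>Minors of size one less than the number of columns\<close>

lemma bij_betw_pick:
  assumes "finite I" shows "bij_betw (pick I) {..<card I} I"
proof -
  have inj: "inj_on (pick I) {..<card I}"
    using assms pick_eq_iff_inf
    by (intro inj_onI) (metis lessThan_iff linorder_neqE_nat pick_mono_le less_irrefl)
  have "pick I ` {..<card I} \<subseteq> I" using pick_in_set_le by auto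
  then have "pick I ` {..<card I} = I"
    using card_image[OF inj] assms by (intro card_subset_eq) auto
  with inj show ?thesis by (simp add: bij_betw_def)
qed

lemma sum_pick:
  assumes "finite I" shows "(\<Sum>i<card I. f (pick I i)) = sum f I"
  using sum.reindex_bij_betw[OF bij_betw_pick[OF assms]] .

lemma submatrix_eq:
  assumes "I \<subseteq> {..<dim_row A}" "J \<subseteq> {..<dim_col A}"
  shows "submatrix A I J = mat (card I) (card J) (\<lambda>(i, j). A $$ (pick I i, pick J j))"
proof -
  have "{i. i < dim_row A \<and> i \<in> I} = I" "{i. i < dim_col A \<and> i \<in> J} = J"
    using assms by auto
  then show ?thesis by (simp add: submatrix_def)
qed

text \<open>Matches the skipped index in \<open>mat_delete\<close> with the enumeration by
  \<open>pick\<close> in \<open>submatrix\<close>.\<close>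

lemma pick_delete:
  assumes "i < N" "k < N - 1"
  shows "pick ({..<N} - {i}) k = (if k < i then k else Suc k)"
proof -
  let ?I = "{..<N} - {i}" and ?p = "if k < i then k else Suc k"
  have "?p \<in> ?I" using assms by auto
  moreover have "card {a \<in> ?I. a < ?p} = k"
  proof (cases "k < i")
    case True
    then have "{a \<in> ?I. a < ?p} = {..<k}" using assms by auto
    then show ?thesis by simp
  next
    case False
    then have "{a \<in> ?I. a < ?p} = {..<Suc k} - {i}" using assms by auto
    then show ?thesis using False by simp
  qed
  ultimately show ?thesis using pick_card_in_set[of ?p ?I] by simp
qed

text \<open>\<open>B\<close> is \<open>A\<close> without its column 0 and with a new, arbitrary last
  column. Expanding along that column, every cofactor is up to sign a minor of
  \<open>A\<close>.\<close>

lemma dvd_det_of_dvd_minors: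
  fixes A B :: "'a :: comm_ring_1 mat"
  assumes A: "A \<in> carrier_mat N N" and B: "B \<in> carrier_mat N N" and N: "N > 0"
    and AB: "\<And>r j. r < N \<Longrightarrow> j < N - 1 \<Longrightarrow> B $$ (r, j) = A $$ (r, Suc j)"
    and q: "\<And>m. m \<in> minors (N - 1) A \<Longrightarrow> q dvd m"
  shows "q dvd det B"
proof -
  have "q dvd cofactor B i (N - 1)" if i: "i < N" for i
  proof -
    let ?I = "{..<N} - {i}" and ?J = "{..<N} - {0::nat}"
    have "mat_delete B i (N - 1) = submatrix A ?I ?J"
      using A B i N
      by (subst submatrix_eq)
        (auto intro!: eq_matI simp: mat_delete_def pick_delete AB)
    moreover have "card ?I = N - 1" "card ?J = N - 1" using i N by auto
    ultimately have "det (mat_delete B i (N - 1)) \<in> minors (N - 1) A"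
      unfolding minors_def using A by (intro CollectI exI[of _ ?I] exI[of _ ?J]) auto
    then show ?thesis unfolding cofactor_def by (simp add: q)
  qed
  moreover have "det B = (\<Sum>i<N. B $$ (i, N - 1) * cofactor B i (N - 1))"
    by (rule laplace_expansion_column[OF B]) (use N in simp)
  ultimately show ?thesis by (auto intro!: dvd_sum)
qed

text \<open>Zero row sums mean that colours matter only up to a common constant. A minor of size
  \<open>N - 1\<close> omits a single column \<open>g\<^sub>0\<close>, so the colouring can be
  normalised to vanish there, and \<open>det_dvd_of_colouring\<close> applies to whichever rows are
  left.\<close>

lemma det_dvd_minors:
  fixes A S :: "'a :: idom mat" and B C \<Delta> K :: "nat \<Rightarrow> nat \<Rightarrow> 'a"
  assumes A: "A \<in> carrier_mat N N" and S: "S \<in> carrier_mat n n" and N: "N > 0"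
    and A1: "\<And>r. r < N \<Longrightarrow> (\<Sum>g<N. A $$ (r, g)) = 0"
    and AB: "\<And>r k. r < N \<Longrightarrow> k < n \<Longrightarrow> (\<Sum>g<N. A $$ (r, g) * B g k) = (\<Sum>j<n. C r j * S $$ (j, k))"
    and \<Delta>1: "\<And>i. i < n \<Longrightarrow> (\<Sum>g<N. \<Delta> i g) = 0"
    and \<Delta>B: "\<And>i k. i < n \<Longrightarrow> k < n \<Longrightarrow>
      (\<Sum>g<N. \<Delta> i g * B g k) = (if i = k then 1 else 0) + (\<Sum>j<n. K i j * S $$ (j, k))"
    and m: "m \<in> minors (N - 1) A"
  shows "det S dvd m"
proof -
  obtain I J where IJ: "m = det (submatrix A I J)" "I \<subseteq> {..<N}" "J \<subseteq> {..<N}"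
    "card I = N - 1" "card J = N - 1"
    using m A unfolding minors_def by auto
  have fin: "finite I" "finite J" using IJ(2,3) finite_subset by auto
  have "card ({..<N} - J) = 1"
    using IJ N fin by (simp add: card_Diff_subset)
  then obtain g\<^sub>0 where g0: "{..<N} - J = {g\<^sub>0}" using card_1_singletonE by blast
  have J: "g\<^sub>0 < N" "J = {..<N} - {g\<^sub>0}" using g0 IJ(3) by auto
  have pI: "pick I i < N" if "i < N - 1" for i
    using that IJ pick_in_set_le by (metis lessThan_iff subsetD)
  \<comment> \<open>Subtracting the colour of the omitted column kills its term and, by the zero
    sum, leaves the total unchanged.\<close>
  have shift: "(\<Sum>j<N - 1. f (pick J j) * (B (pick J j) k - B g\<^sub>0 k)) = (\<Sum>g<N. f g * B g k)"
    if "(\<Sum>g<N. f g) = 0" for f :: "nat \<Rightarrow> 'a" and k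
  proof -
    have "(\<Sum>j<N - 1. f (pick J j) * (B (pick J j) k - B g\<^sub>0 k)) = (\<Sum>g\<in>J. f g * (B g k - B g\<^sub>0 k))"
      using sum_pick[OF fin(2), of "\<lambda>g. f g * (B g k - B g\<^sub>0 k)"] IJ by simp
    also have "\<dots> = (\<Sum>g<N. f g * (B g k - B g\<^sub>0 k))"
      by (rule sum.mono_neutral_left) (use J in auto)
    also have "\<dots> = (\<Sum>g<N. f g * B g k) - (\<Sum>g<N. f g) * B g\<^sub>0 k"
      by (simp add: algebra_simps sum_subtractf sum_distrib_left)
    finally show ?thesis using that by simp
  qed
  let ?M = "submatrix A I J"
  let ?B = "mat (N - 1) n (\<lambda>(j, k). B (pick J j) k - B g\<^sub>0 k)"
  let ?\<Delta> = "mat n (N - 1) (\<lambda>(i, j). \<Delta> i (pick J j))"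
  let ?C = "mat (N - 1) n (\<lambda>(i, j). C (pick I i) j)"
  let ?K = "mat n n (\<lambda>(i, j). K i j)"
  have M: "?M = mat (N - 1) (N - 1) (\<lambda>(i, j). A $$ (pick I i, pick J j))"
    using IJ A by (subst submatrix_eq) auto
  have "det S dvd det ?M"
  proof (rule det_dvd_of_colouring[where B = ?B and \<Delta> = ?\<Delta> and C = ?C and K = ?K and m = "N - 1" and n = n])
    show "?M * ?B = ?C * S"
    proof (rule eq_matI)
      fix i k assume ik: "i < dim_row (?C * S)" "k < dim_col (?C * S)"
      have "(?M * ?B) $$ (i, k) =
          (\<Sum>j<N - 1. A $$ (pick I i, pick J j) * (B (pick J j) k - B g\<^sub>0 k))"
        using ik S M by (auto simp: scalar_prod_def atLeast0LessThan)
      also have "\<dots> = (\<Sum>j<n. C (pick I i) j * S $$ (j, k))"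
        using ik S pI[of i] shift[of "\<lambda>g. A $$ (pick I i, g)" k] A1 AB by auto
      finally show "(?M * ?B) $$ (i, k) = (?C * S) $$ (i, k)"
        using ik S by (auto simp: scalar_prod_def atLeast0LessThan)
    qed (use S M in auto)
    show "?\<Delta> * ?B = 1\<^sub>m n + ?K * S"
    proof (rule eq_matI)
      fix i k assume ik: "i < dim_row (1\<^sub>m n + ?K * S)" "k < dim_col (1\<^sub>m n + ?K * S)"
      have "(?\<Delta> * ?B) $$ (i, k) = (\<Sum>j<N - 1. \<Delta> i (pick J j) * (B (pick J j) k - B g\<^sub>0 k))"
        using ik S by (auto simp: scalar_prod_def atLeast0LessThan)
      also have "\<dots> = (if i = k then 1 else 0) + (\<Sum>j<n. K i j * S $$ (j, k))"
        using ik S shift[of "\<Delta> i" k] \<Delta>1 \<Delta>B by auto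
      finally show "(?\<Delta> * ?B) $$ (i, k) = (1\<^sub>m n + ?K * S) $$ (i, k)"
        using ik S by (auto simp: scalar_prod_def atLeast0LessThan)
    qed (use S in auto)
  qed (use S M in auto)
  then show ?thesis using IJ by simp
qed

section \<open>Colourings modulo a submodule\<close>

text \<open>As in \<open>wirtinger_relator\<close>, every sign other than 1 counts as
  negative.\<close>

definition twist :: "int \<Rightarrow> laurent" where
  "twist s = (if s = 1 then t else t_inv)"

text \<open>The passages along a finger: \<open>g k\<close> on the way out, the tip
  \<open>m\<close>, \<open>h k\<close> on the way back. The recursion peels off the chord nearest to
  the skeleton, which suits induction.\<close>

primrec nest :: "('k \<Rightarrow> 'e list) \<Rightarrow> ('k \<Rightarrow> 'e list) \<Rightarrow> 'e list \<Rightarrow> 'k list \<Rightarrow> 'e list" where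
  "nest g h m [] = m"
| "nest g h m (k # ks) = g k @ nest g h m ks @ h k"

lemma nest_eq: "nest g h m ks = concat (map g ks) @ m @ concat (map h (rev ks))"
  by (induction ks) auto

text \<open>Unlike \<open>over_arc\<close>, not reduced modulo the number of arcs: when the knot is
  cut at the base point, the part behind the last undercrossing is an arc of its own.\<close>

definition arc_before :: "('c \<times> level) list \<Rightarrow> 'c \<times> level \<Rightarrow> nat" where
  "arc_before es e = length (filter (\<lambda>p. snd p = Under) (takeWhile (\<lambda>p. p \<noteq> e) es))"

text \<open>The quotient by \<open>L\<close> is replaced by congruence modulo \<open>L\<close>, so
  that colours remain vectors whose coefficients can be read off.\<close>

locale quotient_module = Modules.module scale
  for scale :: "laurent \<Rightarrow> 'v :: ab_group_add \<Rightarrow> 'v" (infixr \<open>*s\<close> 75) +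
  fixes L :: "'v set"
  assumes L: "subspace L"
begin

definition congr :: "'v \<Rightarrow> 'v \<Rightarrow> bool" (infix \<open>\<approx>\<close> 50) where
  "x \<approx> y \<longleftrightarrow> x - y \<in> L"

lemma congr_refl [simp, intro]: "x \<approx> x"
  by (simp add: congr_def subspace_0 L)

lemma congr_sym: "x \<approx> y \<Longrightarrow> y \<approx> x"
  using subspace_neg[OF L, of "x - y"] by (simp add: congr_def)

lemma congr_trans [trans]: "x \<approx> y \<Longrightarrow> y \<approx> z \<Longrightarrow> x \<approx> z"
  using subspace_add[OF L, of "x - y" "y - z"] by (simp add: congr_def)

lemma congr_add: "x \<approx> y \<Longrightarrow> x' \<approx> y' \<Longrightarrow> x + x' \<approx> y + y'"
  using subspace_add[OF L, of "x - y" "x' - y'"] by (simp add: congr_def algebra_simps)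

lemma congr_scale: "x \<approx> y \<Longrightarrow> c *s x \<approx> c *s y"
  using subspace_scale[OF L, of "x - y" c] by (simp add: congr_def algebra_simps)

lemma congr_minus: "x \<approx> y \<Longrightarrow> - x \<approx> - y"
  using congr_scale[of x y "- 1"] by simp

lemma congr_diff: "x \<approx> y \<Longrightarrow> x' \<approx> y' \<Longrightarrow> x - x' \<approx> y - y'"
  using congr_add[OF _ congr_minus] by fastforce

lemma congr_diff_iff: "x \<approx> y + z \<longleftrightarrow> x - y \<approx> z"
  by (simp add: congr_def algebra_simps)

end

locale colouring = quotient_module scale L
  for scale :: "laurent \<Rightarrow> 'v :: ab_group_add \<Rightarrow> 'v" (infixr \<open>*s\<close> 75) and L +
  fixes sgn :: "'c \<Rightarrow> int" and w :: "'c \<Rightarrow> 'v" and col :: "'c \<times> level \<Rightarrow> 'v"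
begin

definition after :: "'c \<times> level \<Rightarrow> 'v" where
  "after e = (if snd e = Over then col e
     else twist (sgn (fst e)) *s col e + (1 - twist (sgn (fst e))) *s w (fst e))"

text \<open>\<open>chain x es y\<close>: the colours \<open>col\<close> before the passages \<open>es\<close> are those of a strand that starts with
  \<open>x\<close> and ends with \<open>y\<close>. The colours \<open>w\<close> of the upper strands are independent of \<open>col\<close>, since they will
  also be prescribed in advance.\<close>

primrec chain :: "'v \<Rightarrow> ('c \<times> level) list \<Rightarrow> 'v \<Rightarrow> bool" where
  "chain x [] y \<longleftrightarrow> x \<approx> y"
| "chain x (e # es) y \<longleftrightarrow> col e \<approx> x \<and> chain (after e) es y"

lemma chain_congr:
  assumes "chain x es y" "x \<approx> x'" "y \<approx> y'" shows "chain x' es y'"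
  using assms
proof (induction es arbitrary: x x')
  case Nil
  then show ?case by (auto intro: congr_trans congr_sym)
next
  case (Cons e es)
  then show ?case by (auto intro: congr_trans)
qed

lemma chain_append: "chain x (as @ bs) z \<longleftrightarrow> (\<exists>y. chain x as y \<and> chain y bs z)"
proof (induction as arbitrary: x)
  case Nil
  show ?case using chain_congr[of _ bs z] congr_sym by auto
qed auto

text \<open>\<open>f\<close> colours the arcs by their numbers. A piece \<open>ys\<close> of the
  code begins on the arc whose number counts the undercrossings in \<open>xs\<close>; the induction
  moves the passages from \<open>ys\<close> to \<open>xs\<close> one by one.\<close>

lemma chain_of_arcs:
  assumes "distinct (xs @ ys @ zs)"
    and "\<And>r. r < length (filter (\<lambda>p. snd p = Under) (xs @ ys)) \<Longrightarrow>
      f (Suc r) \<approx> twist (sgn (c r)) *s f r + (1 - twist (sgn (c r))) *s w (c r)"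
    and "\<And>r. r < length (filter (\<lambda>p. snd p = Under) (xs @ ys)) \<Longrightarrow>
      c r = fst (filter (\<lambda>p. snd p = Under) (xs @ ys) ! r)"
    and "\<And>e. e \<in> set ys \<Longrightarrow> col e = f (arc_before (xs @ ys @ zs) e)"
  shows "chain (f (length (filter (\<lambda>p. snd p = Under) xs))) ys
    (f (length (filter (\<lambda>p. snd p = Under) (xs @ ys))))"
  using assms
proof (induction ys arbitrary: xs)
  case (Cons e ys)
  let ?n = "length (filter (\<lambda>p. snd p = Under) xs)"
  \<comment> \<open>By distinctness, the prefix in front of \<open>e\<close> is exactly
    \<open>xs\<close>.\<close>
  have "takeWhile (\<lambda>p. p \<noteq> e) (xs @ e # ys @ zs) = xs"
    using Cons.prems(1) by (subst takeWhile_append2) auto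
  then have col: "col e = f ?n"
    using Cons.prems(4)[of e] by (simp add: arc_before_def)
  have IH: "chain (f (length (filter (\<lambda>p. snd p = Under) (xs @ [e])))) ys
      (f (length (filter (\<lambda>p. snd p = Under) ((xs @ [e]) @ ys))))"
    using Cons.prems by (intro Cons.IH) auto
  have "f (length (filter (\<lambda>p. snd p = Under) (xs @ [e]))) \<approx> after e"
  proof (cases "snd e")
    case Over
    then show ?thesis by (simp add: after_def col)
  next
    case Under
    have "c ?n = fst e"
      using Cons.prems(3)[of ?n] Under by (simp add: nth_append)
    then show ?thesis
      using Cons.prems(2)[of ?n] Under by (simp add: after_def col)
  qed
  then show ?case using chain_congr[OF IH] col by auto
qed simp

text \<open>The two strands of a finger are antiparallel, so the factors \<open>t_inv\<close> and
  \<open>t\<close> cancel, and only a shift by a multiple of the difference of the upper colours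
  remains.\<close>

lemma chain_under_pair:
  assumes "chain x [(a, Under), (b, Under)] y" and "sgn a \<noteq> 1" "sgn b = 1"
  shows "y \<approx> x + (1 - t) *s (w b - w a)"
proof -
  have *: "col (a, Under) \<approx> x" "col (b, Under) \<approx> after (a, Under)" "y \<approx> after (b, Under)"
    using assms(1) congr_sym by auto
  have "y \<approx> t *s col (b, Under) + (1 - t) *s w b"
    using *(3) assms by (simp add: after_def twist_def)
  also have "\<dots> \<approx> t *s (t_inv *s x + (1 - t_inv) *s w a) + (1 - t) *s w b"
  proof (intro congr_add congr_scale congr_refl)
    have "col (b, Under) \<approx> t_inv *s col (a, Under) + (1 - t_inv) *s w a"
      using *(2) assms by (simp add: after_def twist_def)
    also have "\<dots> \<approx> t_inv *s x + (1 - t_inv) *s w a"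
      by (intro congr_add congr_scale congr_refl *(1))
    finally show "col (b, Under) \<approx> t_inv *s x + (1 - t_inv) *s w a" .
  qed
  also have "\<dots> = x + (1 - t) *s (w b - w a)"
    by (simp add: algebra_simps)
  finally show ?thesis .
qed

lemma chain_over_pair:
  assumes "chain x [(a, Over), (b, Over)] y"
  shows "col (a, Over) \<approx> x" "col (b, Over) \<approx> x" "y \<approx> x"
proof -
  have *: "col (a, Over) \<approx> x" "col (b, Over) \<approx> col (a, Over)" "y \<approx> col (b, Over)"
    using assms congr_sym by (auto simp: after_def)
  then show "col (a, Over) \<approx> x" "col (b, Over) \<approx> x" "y \<approx> x"
    using congr_trans by blast+
qed

end

text \<open>The outgoing strand of the finger meets \<open>out\<^sub>1 k\<close>, then \<open>out\<^sub>2 k\<close>, and the returning one meets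
  \<open>back\<^sub>1 k\<close>, then \<open>back\<^sub>2 k\<close>, all at the crossing of the finger with the \<open>k\<close>-th chord. In \<open>chain_nest\<close>,
  \<open>s k\<close> is the resulting shift of the outgoing strand.\<close>

locale finger = colouring scale L sgn w col
  for scale :: "laurent \<Rightarrow> 'v :: ab_group_add \<Rightarrow> 'v" (infixr \<open>*s\<close> 75) and L
    and sgn :: "'c \<Rightarrow> int" and w and col +
  fixes out\<^sub>1 out\<^sub>2 back\<^sub>1 back\<^sub>2 :: "nat \<Rightarrow> 'c" and lev :: "nat \<Rightarrow> level" and ks :: "nat list"
begin

abbreviation strand_out :: "nat \<Rightarrow> ('c \<times> level) list" where
  "strand_out k \<equiv> [(out\<^sub>1 k, lev k), (out\<^sub>2 k, lev k)]"

abbreviation strand_back :: "nat \<Rightarrow> ('c \<times> level) list" where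
  "strand_back k \<equiv> [(back\<^sub>1 k, lev k), (back\<^sub>2 k, lev k)]"

text \<open>Passing over does not change a colour. Nothing is assumed about the colours of upper
  strands, so this is available before any of them is known.\<close>

lemma chain_nest_over:
  assumes "chain x (nest strand_out strand_back tip js) y" "k \<in> set js" "lev k = Over"
  shows "col (out\<^sub>1 k, Over) \<approx> col (out\<^sub>2 k, Over) \<and> col (back\<^sub>1 k, Over) \<approx> col (back\<^sub>2 k, Over)"
  using assms
proof (induction js arbitrary: x y)
  case (Cons j js)
  obtain x' y' where *: "chain x (strand_out j) x'" "chain x' (nest strand_out strand_back tip js) y'"
    "chain y' (strand_back j) y"
    using Cons.prems(1) unfolding nest.simps chain_append by blast
  show ?case
  proof (cases "k = j")
    case True
    have "col (out\<^sub>1 k, Over) \<approx> x" "col (out\<^sub>2 k, Over) \<approx> x"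
      using chain_over_pair[of x "out\<^sub>1 k" "out\<^sub>2 k" x'] *(1) True Cons.prems(3) by auto
    moreover have "col (back\<^sub>1 k, Over) \<approx> y'" "col (back\<^sub>2 k, Over) \<approx> y'"
      using chain_over_pair[of y' "back\<^sub>1 k" "back\<^sub>2 k" y] *(3) True Cons.prems(3) by auto
    ultimately show ?thesis by (blast intro: congr_trans congr_sym)
  next
    case False
    then show ?thesis using Cons * by auto
  qed
qed simp

text \<open>The returning strand meets the same upper colours as the outgoing one in reverse order,
  so its shifts are the negatives. Peeling off the chords from the outside therefore shows that the
  difference \<open>p' - p\<close> at the tip persists along the whole finger.\<close>

lemma chain_nest:
  assumes "chain x (nest strand_out strand_back tip ks) y" and "distinct ks"
    and signs: "\<And>k. k \<in> set ks \<Longrightarrow> lev k = Under \<Longrightarrow>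
      sgn (out\<^sub>1 k) \<noteq> 1 \<and> sgn (out\<^sub>2 k) = 1 \<and> sgn (back\<^sub>1 k) \<noteq> 1 \<and> sgn (back\<^sub>2 k) = 1"
    and over_strands: "\<And>k. k \<in> set ks \<Longrightarrow> lev k = Under \<Longrightarrow>
      w (back\<^sub>1 k) \<approx> w (out\<^sub>2 k) \<and> w (back\<^sub>2 k) \<approx> w (out\<^sub>1 k) \<and> (1 - t) *s (w (out\<^sub>2 k) - w (out\<^sub>1 k)) \<approx> s k"
    and s0: "\<And>k. k \<in> set ks \<Longrightarrow> lev k = Over \<Longrightarrow> s k = 0"
  shows "\<exists>p p'. chain p tip p' \<and> p \<approx> x + sum_list (map s ks) \<and> y \<approx> x + (p' - p) \<and>
    (\<forall>k\<in>set ks. lev k = Over \<longrightarrow>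
      (let z = x + sum_list (map s (takeWhile (\<lambda>j. j \<noteq> k) ks)) in
        col (out\<^sub>1 k, Over) \<approx> z \<and> col (out\<^sub>2 k, Over) \<approx> z \<and>
        col (back\<^sub>1 k, Over) \<approx> z + (p' - p) \<and> col (back\<^sub>2 k, Over) \<approx> z + (p' - p)))"
  using assms
proof (induction ks arbitrary: x y)
  case Nil
  then show ?case
    by (intro exI[of _ x] exI[of _ y]) simp
next
  case (Cons j js)
  obtain x' y' where *: "chain x (strand_out j) x'" "chain x' (nest strand_out strand_back tip js) y'"
    "chain y' (strand_back j) y"
    using Cons.prems(1) unfolding nest.simps chain_append by blast
  have x': "x' \<approx> x + s j" and y: "y \<approx> y' - s j"
  proof -
    show "x' \<approx> x + s j"
    proof (cases "lev j")
      case Over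
      then show ?thesis using chain_over_pair(3)[of x "out\<^sub>1 j" "out\<^sub>2 j" x'] *(1) Cons.prems(5)[of j] by simp
    next
      case Under
      then have "x' \<approx> x + (1 - t) *s (w (out\<^sub>2 j) - w (out\<^sub>1 j))"
        using chain_under_pair[of x "out\<^sub>1 j" "out\<^sub>2 j" x'] *(1) Cons.prems(3)[of j] by simp
      also have "\<dots> \<approx> x + s j"
        using Cons.prems(4)[of j] Under by (intro congr_add) auto
      finally show ?thesis .
    qed
    show "y \<approx> y' - s j"
    proof (cases "lev j")
      case Over
      then show ?thesis using chain_over_pair(3)[of y' "back\<^sub>1 j" "back\<^sub>2 j" y] *(3) Cons.prems(5)[of j] by simp
    next
      case Under
      then have "y \<approx> y' + (1 - t) *s (w (back\<^sub>2 j) - w (back\<^sub>1 j))"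
        using chain_under_pair[of y' "back\<^sub>1 j" "back\<^sub>2 j" y] *(3) Cons.prems(3)[of j] by simp
      \<comment> \<open>On the way back the order is reversed: \<open>back\<^sub>2\<close> carries
        the upper colour of \<open>out\<^sub>1\<close>, and \<open>back\<^sub>1\<close> that of
        \<open>out\<^sub>2\<close>.\<close>
      also have "\<dots> \<approx> y' + (1 - t) *s (w (out\<^sub>1 j) - w (out\<^sub>2 j))"
        using Cons.prems(4)[of j] Under by (intro congr_add congr_scale congr_diff) auto
      also have "\<dots> = y' - (1 - t) *s (w (out\<^sub>2 j) - w (out\<^sub>1 j))"
        by (simp add: algebra_simps)
      also have "\<dots> \<approx> y' - s j"
        using Cons.prems(4)[of j] Under by (intro congr_diff) auto
      finally show ?thesis .
    qed
  qed
  have "\<exists>p p'. chain p tip p' \<and> p \<approx> x' + sum_list (map s js) \<and> y' \<approx> x' + (p' - p) \<and>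
    (\<forall>k\<in>set js. lev k = Over \<longrightarrow>
      (let z = x' + sum_list (map s (takeWhile (\<lambda>j. j \<noteq> k) js)) in
        col (out\<^sub>1 k, Over) \<approx> z \<and> col (out\<^sub>2 k, Over) \<approx> z \<and>
        col (back\<^sub>1 k, Over) \<approx> z + (p' - p) \<and> col (back\<^sub>2 k, Over) \<approx> z + (p' - p)))"
    using *(2) Cons.prems(2-5) by (intro Cons.IH) auto
  then obtain p p' where tip: "chain p tip p'" "p \<approx> x' + sum_list (map s js)" "y' \<approx> x' + (p' - p)"
    and cols: "\<And>k z. k \<in> set js \<Longrightarrow> lev k = Over \<Longrightarrow>
        z = x' + sum_list (map s (takeWhile (\<lambda>j. j \<noteq> k) js)) \<Longrightarrow>
        col (out\<^sub>1 k, Over) \<approx> z \<and> col (out\<^sub>2 k, Over) \<approx> z \<and>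
        col (back\<^sub>1 k, Over) \<approx> z + (p' - p) \<and> col (back\<^sub>2 k, Over) \<approx> z + (p' - p)"
    unfolding Let_def by blast
  have p: "p \<approx> x + sum_list (map s (j # js))"
    using congr_trans[OF tip(2) congr_add[OF x' congr_refl]] by (simp add: add.assoc)
  \<comment> \<open>The shift on the way out and the one on the way back cancel.\<close>
  have "y \<approx> (x + s j) + (p' - p) - s j"
    by (rule congr_trans[OF y congr_diff[OF congr_trans[OF tip(3) congr_add[OF x' congr_refl]] congr_refl]])
  then have y2: "y \<approx> x + (p' - p)"
    by (simp add: algebra_simps)
  have cols': "col (out\<^sub>1 k, Over) \<approx> z \<and> col (out\<^sub>2 k, Over) \<approx> z \<and>
        col (back\<^sub>1 k, Over) \<approx> z + (p' - p) \<and> col (back\<^sub>2 k, Over) \<approx> z + (p' - p)"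
    if k: "k \<in> set (j # js)" "lev k = Over"
      and z: "z = x + sum_list (map s (takeWhile (\<lambda>j. j \<noteq> k) (j # js)))" for k z
  proof (cases "k = j")
    case True
    have over: "lev j = Over" and sj: "s j = 0" and zx: "z = x"
      using True k z Cons.prems(5)[of j] by auto
    have "y' \<approx> x + (p' - p)"
      using congr_trans[OF congr_sym[OF y] y2] sj by simp
    then have "col (back\<^sub>1 j, Over) \<approx> x + (p' - p)" "col (back\<^sub>2 j, Over) \<approx> x + (p' - p)"
      using chain_over_pair[of y' "back\<^sub>1 j" "back\<^sub>2 j" y] *(3) over congr_trans by auto
    moreover have "col (out\<^sub>1 j, Over) \<approx> x" "col (out\<^sub>2 j, Over) \<approx> x"
      using chain_over_pair[of x "out\<^sub>1 j" "out\<^sub>2 j" x'] *(1) over by auto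
    ultimately show ?thesis using True zx by simp
  next
    case False
    let ?z = "x' + sum_list (map s (takeWhile (\<lambda>j. j \<noteq> k) js))"
    have "?z \<approx> z"
      using congr_add[OF x' congr_refl, of "sum_list (map s (takeWhile (\<lambda>j. j \<noteq> k) js))"] z False
      by (auto simp: add.assoc)
    then show ?thesis
      using cols[of k ?z] k False by (auto intro: congr_trans congr_add)
  qed
  show ?case
    unfolding Let_def using tip(1) p y2 cols' by blast
qed

end

section \<open>The Gauss code of the realization\<close>

lemma set_nest: "set (nest g h m ks) = set m \<union> (\<Union>k\<in>set ks. set (g k) \<union> set (h k))"
  by (induction ks) auto

text \<open>\<open>key\<close> reads off the chord at which a passage takes place, so neither blocks
  of different chords nor a block and the tip can share a passage.\<close>

lemma distinct_nest:
  assumes "distinct ks" "distinct m" "\<And>k. k \<in> set ks \<Longrightarrow> distinct (g k @ h k)"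
    and "\<And>k e. k \<in> set ks \<Longrightarrow> e \<in> set (g k) \<union> set (h k) \<Longrightarrow> key e = Some k"
    and "\<And>e. e \<in> set m \<Longrightarrow> key e = None"
  shows "distinct (nest g h m ks)"
  using assms
proof (induction ks)
  case (Cons k ks)
  have key: "key e = None \<or> (\<exists>k'\<in>set ks. key e = Some k')" if "e \<in> set (nest g h m ks)" for e
    using that Cons.prems(4,5) unfolding set_nest by auto
  have "set (g k) \<inter> set (nest g h m ks) = {}" "set (h k) \<inter> set (nest g h m ks) = {}"
    using key Cons.prems(1) Cons.prems(4)[of k] by fastforce+
  then show ?case using Cons by auto
qed simp

definition left_partners :: "clasp_diagram \<Rightarrow> nat \<Rightarrow> nat list" where
  "left_partners D j = sort_key (right_end D) (filter (\<lambda>i. intersecting D i j) [0..<j])"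

text \<open>Listed from the skeleton to the tip: going up its right leg, a finger first meets the
  lowest bars, which belong to the largest numbers.\<close>

definition right_partners :: "clasp_diagram \<Rightarrow> nat \<Rightarrow> nat list" where
  "right_partners D i = rev (filter (\<lambda>j. intersecting D i j) [Suc i..<num_chords D])"

abbreviation left_tip :: "clasp_diagram \<Rightarrow> nat \<Rightarrow> (crossing \<times> level) list" where
  "left_tip D j \<equiv> [(ClaspCrossing j Upper, left_clasp_level D j Upper),
    (ClaspCrossing j Lower, left_clasp_level D j Lower)]"

abbreviation right_tip :: "clasp_diagram \<Rightarrow> nat \<Rightarrow> (crossing \<times> level) list" where
  "right_tip D i \<equiv> [(ClaspCrossing i Lower, right_clasp_level D i Lower),
    (ClaspCrossing i Upper, right_clasp_level D i Upper)]"

lemma left_finger_nest: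
  "left_finger D j = nest
    (\<lambda>i. [(FingerCrossing i j Out Out, finger_level D j i), (FingerCrossing i j Back Out, finger_level D j i)])
    (\<lambda>i. [(FingerCrossing i j Back Back, finger_level D j i), (FingerCrossing i j Out Back, finger_level D j i)])
    (left_tip D j) (left_partners D j)"
  by (simp add: left_finger_def nest_eq left_partners_def Let_def)

lemma right_finger_nest:
  "right_finger D i = nest
    (\<lambda>j. [(FingerCrossing i j Out Back, finger_level D i j), (FingerCrossing i j Out Out, finger_level D i j)])
    (\<lambda>j. [(FingerCrossing i j Back Out, finger_level D i j), (FingerCrossing i j Back Back, finger_level D i j)])
    (right_tip D i) (right_partners D i)"
  by (simp add: right_finger_def nest_eq right_partners_def Let_def)

lemma set_left_partners: "set (left_partners D j) = {i. i < j \<and> intersecting D i j}"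
  by (auto simp: left_partners_def)

lemma set_right_partners: "set (right_partners D i) = {j. i < j \<and> j < num_chords D \<and> intersecting D i j}"
  by (auto simp: right_partners_def)

lemma distinct_left_partners: "distinct (left_partners D j)"
  by (simp add: left_partners_def)

lemma distinct_right_partners: "distinct (right_partners D i)"
  by (simp add: right_partners_def)

text \<open>The chord met by \<open>k\<close> at a crossing; the key for distinctness within a
  single finger.\<close>

fun partner :: "nat \<Rightarrow> crossing \<Rightarrow> nat option" where
  "partner k (FingerCrossing i j p q) = Some (if k = j then i else j)"
| "partner k (ClaspCrossing i u) = None"

lemma distinct_left_finger: "distinct (left_finger D j)"
  unfolding left_finger_nest
  by (rule distinct_nest[where key = "\<lambda>e. partner j (fst e)"]) (auto simp: distinct_left_partners)

lemma distinct_right_finger: "distinct (right_finger D i)"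
  unfolding right_finger_nest
  by (rule distinct_nest[where key = "\<lambda>e. partner i (fst e)"])
    (auto simp: distinct_right_partners set_right_partners)

text \<open>The two passages of a crossing of the realization have different levels, so the level
  tells at which endpoint the passing finger starts. This separates the passages of different
  fingers.\<close>

fun event_position :: "clasp_diagram \<Rightarrow> crossing \<times> level \<Rightarrow> nat" where
  "event_position D (FingerCrossing i j p q, lev) =
    (if lev = finger_level D i j then right_end D i else left_end D j)"
| "event_position D (ClaspCrossing i u, lev) =
    (if lev = left_clasp_level D i u then left_end D i else right_end D i)"

lemma distinct_concat_by_key:
  assumes "\<And>x. x < m \<Longrightarrow> distinct (f x)" "\<And>x e. x < m \<Longrightarrow> e \<in> set (f x) \<Longrightarrow> key e = x"
  shows "distinct (concat (map f [0..<m]))"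
  using assms
proof (induction m)
  case (Suc m)
  have "key e < m" if "e \<in> set (concat (map f [0..<m]))" for e
  proof -
    from that obtain x where "x < m" "e \<in> set (f x)" by auto
    with Suc.prems(2)[of x e] show ?thesis by simp
  qed
  moreover have "key e = m" if "e \<in> set (f m)" for e
    using that Suc.prems(2) by simp
  ultimately have "set (concat (map f [0..<m])) \<inter> set (f m) = {}"
    by (metis disjoint_iff less_irrefl)
  then show ?case using Suc by auto
qed simp

section \<open>Endpoints, fingers and crossings of a fixed diagram\<close>

locale clasp =
  fixes D :: clasp_diagram
  assumes D: "long_clasp_diagram D"
begin

abbreviation n where "n \<equiv> num_chords D"
abbreviation l where "l \<equiv> left_end D"
abbreviation r where "r \<equiv> right_end D"
abbreviation \<epsilon> where "\<epsilon> \<equiv> chord_sign D"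

lemma l_less_r: "i < n \<Longrightarrow> l i < r i"
  using D by (simp add: long_clasp_diagram_def Let_def)

lemma l_less_iff: "i < n \<Longrightarrow> j < n \<Longrightarrow> l i < l j \<longleftrightarrow> i < j"
  using D unfolding long_clasp_diagram_def Let_def strict_mono_on_def
  by (metis lessThan_iff linorder_neqE_nat order_less_asym)

lemma l_eq_iff: "i < n \<Longrightarrow> j < n \<Longrightarrow> l i = l j \<longleftrightarrow> i = j"
  using l_less_iff by (metis linorder_neqE_nat order_less_irrefl)

lemma r_eq_iff: "i < n \<Longrightarrow> j < n \<Longrightarrow> r i = r j \<longleftrightarrow> i = j"
  using D by (auto simp: long_clasp_diagram_def Let_def inj_on_def)

lemma l_neq_r: "i < n \<Longrightarrow> j < n \<Longrightarrow> l i \<noteq> r j"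
  using D by (auto simp: long_clasp_diagram_def Let_def)

lemma ends: "l ` {..<n} \<union> r ` {..<n} = {..<2 * n}"
  using D by (simp add: long_clasp_diagram_def Let_def)

lemma l_bound: "i < n \<Longrightarrow> l i < 2 * n" and r_bound: "i < n \<Longrightarrow> r i < 2 * n"
  using ends by auto

lemma end_cases:
  assumes "x < 2 * n"
  obtains i where "i < n" "x = l i" | i where "i < n" "x = r i"
  using assms ends by (metis UnE image_iff lessThan_iff)

lemma sign_cases: "i < n \<Longrightarrow> \<epsilon> i = 1 \<or> \<epsilon> i = - 1"
  using D by (auto simp: long_clasp_diagram_def Let_def)

lemma passes_over_iff:
  assumes "i < n" "j < n" "intersecting D i j"
  shows "passes_over D j i \<longleftrightarrow> \<not> passes_over D i j"
proof -
  have "i \<noteq> j" using assms(3) by (auto simp: intersecting_def)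
  then have "height D i \<noteq> height D j"
    using inj_onD[of "height D" "{..<n}" i j] D assms(1,2) by (auto simp: long_clasp_diagram_def Let_def)
  then show ?thesis using assms(3) by (auto simp: passes_over_def intersecting_def)
qed

lemma passes_over_asym: "passes_over D i j \<Longrightarrow> \<not> passes_over D j i"
  by (auto simp: passes_over_def)

lemma passes_over_intersecting: "passes_over D i j \<Longrightarrow> intersecting D i j \<and> intersecting D j i"
  by (auto simp: passes_over_def intersecting_def)

lemma finger_level_cases:
  assumes "i < n" "j < n" "intersecting D i j"
  shows "finger_level D j i = Over \<longleftrightarrow> passes_over D j i" "finger_level D j i = Under \<longleftrightarrow> passes_over D i j"
    "finger_level D i j = Over \<longleftrightarrow> passes_over D i j" "finger_level D i j = Under \<longleftrightarrow> passes_over D j i"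
  using passes_over_iff[OF assms] by (auto simp: finger_level_def)

lemma finger_at_l: "i < n \<Longrightarrow> finger_at D (l i) = left_finger D i"
proof -
  assume i: "i < n"
  then have "(THE k. k < n \<and> l k = l i) = i" using l_eq_iff by (intro the_equality) auto
  then show ?thesis using i by (simp add: finger_at_def)
qed

lemma finger_at_r: "i < n \<Longrightarrow> finger_at D (r i) = right_finger D i"
proof -
  assume i: "i < n"
  then have "(THE k. k < n \<and> r k = r i) = i" using r_eq_iff by (intro the_equality) auto
  moreover have "r i \<notin> l ` {..<n}" using i l_neq_r by fastforce
  ultimately show ?thesis by (simp add: finger_at_def)
qed

lemma event_position_finger:
  assumes "x < 2 * n" "e \<in> set (finger_at D x)"
  shows "event_position D e = x"
proof (cases rule: end_cases[OF assms(1)])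
  case (1 j)
  have "finger_level D j i \<noteq> finger_level D i j" if "i < j" "intersecting D i j" for i
    using finger_level_cases[of i j] passes_over_iff[of i j] 1 that by (auto simp: finger_level_def)
  then show ?thesis
    using assms(2) unfolding 1 finger_at_l[OF 1(1)] left_finger_nest set_nest set_left_partners by auto
next
  case (2 i)
  have "right_clasp_level D i u \<noteq> left_clasp_level D i u" for u
    by (simp add: right_clasp_level_def left_clasp_level_def)
  then show ?thesis
    using assms(2) unfolding 2 finger_at_r[OF 2(1)] right_finger_nest set_nest set_right_partners by auto
qed

lemma distinct_finger_at: "x < 2 * n \<Longrightarrow> distinct (finger_at D x)"
  by (erule end_cases) (simp_all add: finger_at_l finger_at_r distinct_left_finger distinct_right_finger)

lemma distinct_code: "distinct (gauss_code (realization D))"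
  unfolding realization_def
  by (auto intro!: distinct_concat_by_key[where key = "event_position D"] distinct_finger_at event_position_finger)

definition crossings :: "crossing set" where
  "crossings = {FingerCrossing i j p q | i j p q. i < j \<and> j < n \<and> intersecting D i j} \<union>
    {ClaspCrossing i u | i u. i < n}"

lemma undercrossings_subset: "set (undercrossings (realization D)) \<subseteq> crossings"
proof
  fix c assume "c \<in> set (undercrossings (realization D))"
  then obtain x lev where x: "x < 2 * n" "(c, lev) \<in> set (finger_at D x)"
    by (auto simp: undercrossings_def realization_def)
  show "c \<in> crossings"
  proof (cases rule: end_cases[OF x(1)])
    case (1 j)
    then show ?thesis
      using x(2) unfolding 1 finger_at_l[OF 1(1)] left_finger_nest set_nest set_left_partners crossings_def
      by auto
  next
    case (2 i)
    then show ?thesis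
      using x(2) unfolding 2 finger_at_r[OF 2(1)] right_finger_nest set_nest set_right_partners crossings_def
      by auto
  qed
qed

end

section \<open>Explicit colours and clasp relations in terms of the differences\<close>

locale clasp_module = clasp D + quotient_module scale L
  for D and scale :: "laurent \<Rightarrow> 'v :: ab_group_add \<Rightarrow> 'v" (infixr \<open>*s\<close> 75) and L +
  fixes d :: "nat \<Rightarrow> 'v"
begin

text \<open>The colour of the left finger of the chord \<open>i\<close> increases by \<open>d i\<close> from the outgoing to the
  returning strand, that of the right finger decreases by \<open>d i\<close>. So \<open>base x\<close> is the colour of the
  skeleton before the point \<open>x\<close>, and \<open>left_colour\<close> and \<open>right_colour\<close> are the colours in front of the
  clasp.\<close>

definition base :: "nat \<Rightarrow> 'v" where
  "base x = (\<Sum>k<n. (of_bool (l k < x) - of_bool (r k < x)) *s d k)"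

text \<open>A left finger passing under first meets the outgoing strand of a right finger, whose
  difference is \<open>- d k\<close>; a right finger first meets the returning strand of a left
  finger, whose difference is \<open>d k\<close>. The two changes of sign compensate, so one formula
  covers both.\<close>

definition shift :: "nat \<Rightarrow> nat \<Rightarrow> 'v" where
  "shift i k = (if finger_level D i k = Under then (t - 1) *s d k else 0)"

definition left_colour :: "nat \<Rightarrow> 'v" where
  "left_colour j = base (l j) + sum_list (map (shift j) (left_partners D j))"

definition right_colour :: "nat \<Rightarrow> 'v" where
  "right_colour i = base (r i) + sum_list (map (shift i) (right_partners D i))"

text \<open>At a crossing of fingers the last summand depends on the strand of the upper finger. In
  a positive clasp each finger is over at the first passage of its tip, in a negative one at the
  second, after its colour has changed by \<open>d i\<close> or \<open>- d i\<close>.\<close>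

fun over_colour :: "crossing \<Rightarrow> 'v" where
  "over_colour (FingerCrossing i j p q) =
    (if passes_over D i j
     then base (r i) + sum_list (map (shift i) (takeWhile (\<lambda>k. k \<noteq> j) (right_partners D i))) +
       (if p = Out then 0 else - d i)
     else base (l j) + sum_list (map (shift j) (takeWhile (\<lambda>k. k \<noteq> i) (left_partners D j))) +
       (if q = Out then 0 else d j))"
| "over_colour (ClaspCrossing i Upper) = (if \<epsilon> i = 1 then left_colour i else right_colour i - d i)"
| "over_colour (ClaspCrossing i Lower) = (if \<epsilon> i = 1 then right_colour i else left_colour i + d i)"

definition relation :: "nat \<Rightarrow> 'v" where
  "relation i = (\<Sum>k<n. clasp_matrix D $$ (k, i) *s d k)"

lemma base_0: "base 0 = 0"
  by (simp add: base_def)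

text \<open>All chords are closed at the end of the skeleton, so the last arc gets the colour of the
  first one and the colouring closes up.\<close>

lemma base_end: "base (2 * n) = 0"
  unfolding base_def by (rule sum.neutral) (simp add: l_bound r_bound)

lemma base_Suc_l: "i < n \<Longrightarrow> base (Suc (l i)) = base (l i) + d i"
proof -
  assume i: "i < n"
  have "base (Suc (l i)) - base (l i) = (\<Sum>k<n. if k = i then d i else 0)"
    unfolding base_def sum_subtractf [symmetric]
    by (rule sum.cong) (use i l_eq_iff l_neq_r[of i, THEN not_sym] in \<open>auto simp: of_bool_def less_Suc_eq algebra_simps\<close>)
  then show ?thesis using i by (simp add: algebra_simps)
qed

lemma base_Suc_r: "i < n \<Longrightarrow> base (Suc (r i)) = base (r i) - d i"
proof -
  assume i: "i < n"
  have "base (r i) - base (Suc (r i)) = (\<Sum>k<n. if k = i then d i else 0)"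
    unfolding base_def sum_subtractf [symmetric]
    by (rule sum.cong) (use i r_eq_iff l_neq_r[of _ i] in \<open>auto simp: of_bool_def less_Suc_eq algebra_simps\<close>)
  then show ?thesis using i by (simp add: algebra_simps)
qed

text \<open>Padding with zeros turns the sum over partners into one over all chords, for the
  comparison of coefficients in \<open>relation_eq\<close>.\<close>

lemma left_colour_eq:
  assumes j: "j < n"
  shows "left_colour j = base (l j) + (\<Sum>k<n. ((t - 1) * of_bool (k < j \<and> passes_over D k j)) *s d k)"
proof -
  have "sum_list (map (shift j) (left_partners D j)) = (\<Sum>k\<in>{i. i < j \<and> intersecting D i j}. shift j k)"
    by (simp add: sum_list_distinct_conv_sum_set distinct_left_partners set_left_partners)
  also have "\<dots> = (\<Sum>k<n. ((t - 1) * of_bool (k < j \<and> passes_over D k j)) *s d k)"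
    by (rule sum.mono_neutral_cong_left)
      (use j in \<open>auto simp: shift_def finger_level_cases passes_over_intersecting\<close>)
  finally show ?thesis by (simp add: left_colour_def)
qed

lemma right_colour_eq:
  assumes i: "i < n"
  shows "right_colour i = base (r i) + (\<Sum>k<n. ((t - 1) * of_bool (i < k \<and> passes_over D k i)) *s d k)"
proof -
  have "sum_list (map (shift i) (right_partners D i)) =
      (\<Sum>k\<in>{j. i < j \<and> j < n \<and> intersecting D i j}. shift i k)"
    by (simp add: sum_list_distinct_conv_sum_set distinct_right_partners set_right_partners)
  also have "\<dots> = (\<Sum>k<n. ((t - 1) * of_bool (i < k \<and> passes_over D k i)) *s d k)"
    by (rule sum.mono_neutral_cong_left)
      (use i in \<open>auto simp: shift_def finger_level_cases passes_over_intersecting\<close>)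
  finally show ?thesis by (simp add: right_colour_def)
qed

text \<open>The coefficients of each \<open>d k\<close> agree. For \<open>k \<noteq> i\<close> the
  endpoint indicators add up to 0 if the chords do not intersect, to 1 if they do and
  \<open>i < k\<close>, and to -1 if they do and \<open>k < i\<close>; when \<open>k\<close> passes
  over \<open>i\<close>, the shift multiplies this by \<open>t\<close>. For \<open>k = i\<close> the
  indicators give 1, which the term \<open>- d i\<close> cancels.\<close>

lemma relation_eq:
  assumes i: "i < n"
  shows "relation i = (t_inv - 1) *s (right_colour i - left_colour i - d i) - of_int (\<epsilon> i) *s d i"
proof -
  have d: "d i = (\<Sum>k<n. of_bool (k = i) *s d k)"
    using i by (simp add: of_bool_def if_distrib[where f = "\<lambda>c. c *s _"] cong: if_cong)
  have coeff: "clasp_matrix D $$ (k, i) =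
     (t_inv - 1) * ((of_bool (l k < r i) - of_bool (r k < r i)) + (t - 1) * of_bool (i < k \<and> passes_over D k i)
       - ((of_bool (l k < l i) - of_bool (r k < l i)) + (t - 1) * of_bool (k < i \<and> passes_over D k i))
       - of_bool (k = i)) - of_int (\<epsilon> i) * of_bool (k = i)" if k: "k < n" for k
  proof -
    consider "k = i" | "k < i" | "i < k" by linarith
    then show ?thesis
    proof cases
      case 1
      then show ?thesis using i l_less_r[OF i] by (simp add: clasp_matrix_def passes_over_def intersecting_def)
    next
      case 2
      have lr: "l k < l i" "l i < r i" "l k < r k" "r k \<noteq> l i" "r k \<noteq> r i"
        using 2 i k l_less_iff l_less_r l_neq_r[of i k] r_eq_iff[of k i] by auto
      have int: "intersecting D k i \<longleftrightarrow> l i < r k \<and> r k < r i" "intersecting D i k \<longleftrightarrow> l i < r k \<and> r k < r i"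
        using lr by (auto simp: intersecting_def)
      show ?thesis
      proof (cases "intersecting D k i")
        case True
        then show ?thesis
          using 2 i k lr int passes_over_iff[of k i]
          by (cases "passes_over D k i") (auto simp: clasp_matrix_def algebra_simps)
      next
        case False
        then have "\<not> passes_over D k i" "\<not> passes_over D i k" using passes_over_intersecting by auto
        then show ?thesis using 2 i k lr int False by (auto simp: clasp_matrix_def)
      qed
    next
      case 3
      have lr: "l i < l k" "l i < r i" "l k < r k" "l k \<noteq> r i" "r k \<noteq> r i"
        using 3 i k l_less_iff l_less_r l_neq_r[of k i] r_eq_iff[of k i] by auto
      have int: "intersecting D k i \<longleftrightarrow> l k < r i \<and> r i < r k" "intersecting D i k \<longleftrightarrow> l k < r i \<and> r i < r k"
        using lr by (auto simp: intersecting_def)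
      show ?thesis
      proof (cases "intersecting D k i")
        case True
        then show ?thesis
          using 3 i k lr int passes_over_iff[of k i]
          by (cases "passes_over D k i") (auto simp: clasp_matrix_def algebra_simps)
      next
        case False
        then have "\<not> passes_over D k i" "\<not> passes_over D i k" using passes_over_intersecting by auto
        then show ?thesis using 3 i k lr int False by (auto simp: clasp_matrix_def)
      qed
    qed
  qed
  have "relation i = (\<Sum>k<n. (t_inv - 1) *s (
       ((of_bool (l k < r i) - of_bool (r k < r i)) *s d k + ((t - 1) * of_bool (i < k \<and> passes_over D k i)) *s d k)
       - ((of_bool (l k < l i) - of_bool (r k < l i)) *s d k + ((t - 1) * of_bool (k < i \<and> passes_over D k i)) *s d k)
       - of_bool (k = i) *s d k) - of_int (\<epsilon> i) *s (of_bool (k = i) *s d k))"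
    unfolding relation_def
    by (rule sum.cong)
      (simp_all only: lessThan_iff coeff scale_scale scale_left_distrib [symmetric] scale_left_diff_distrib [symmetric])
  also have "\<dots> = (t_inv - 1) *s (right_colour i - left_colour i - d i) - of_int (\<epsilon> i) *s d i"
    unfolding left_colour_eq[OF i] right_colour_eq[OF i] base_def
    by (simp only: sum_subtractf sum.distrib scale_sum_right [symmetric] d [symmetric])
  finally show ?thesis .
qed

end

section \<open>Colours along the fingers\<close>

context quotient_module
begin

lemma congr_0_iff: "x \<approx> y \<longleftrightarrow> x - y \<approx> 0"
  by (simp add: congr_def)

lemma congr_0_add: "x \<approx> 0 \<Longrightarrow> y \<approx> 0 \<Longrightarrow> x + y \<approx> 0"
  using congr_add[of x 0 y 0] by simp

lemma congr_0_scale: "x \<approx> 0 \<Longrightarrow> c *s x \<approx> 0"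
  using congr_scale[of x 0 c] by simp

end

context colouring
begin

lemma chain_over_under:
  assumes "chain x [(a, Over), (b, Under)] y"
  shows "col (a, Over) \<approx> x" "y \<approx> twist (sgn b) *s x + (1 - twist (sgn b)) *s w b"
proof -
  have *: "col (a, Over) \<approx> x" "col (b, Under) \<approx> col (a, Over)"
    "twist (sgn b) *s col (b, Under) + (1 - twist (sgn b)) *s w b \<approx> y"
    using assms by (simp_all add: after_def)
  then show "col (a, Over) \<approx> x" "y \<approx> twist (sgn b) *s x + (1 - twist (sgn b)) *s w b"
    using congr_trans[OF congr_sym[OF *(3)] congr_add[OF congr_scale[OF congr_trans[OF *(2) *(1)]] congr_refl]]
    by auto
qed

lemma chain_under_over:
  assumes "chain x [(a, Under), (b, Over)] y"
  shows "col (b, Over) \<approx> y" "y \<approx> twist (sgn a) *s x + (1 - twist (sgn a)) *s w a"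
proof -
  have *: "col (a, Under) \<approx> x" "col (b, Over) \<approx> y"
    "col (b, Over) \<approx> twist (sgn a) *s col (a, Under) + (1 - twist (sgn a)) *s w a"
    using assms by (simp_all add: after_def)
  then show "col (b, Over) \<approx> y" "y \<approx> twist (sgn a) *s x + (1 - twist (sgn a)) *s w a"
    using congr_trans[OF congr_trans[OF congr_sym[OF *(2)] *(3)] congr_add[OF congr_scale[OF *(1)] congr_refl]]
    by auto
qed

end

text \<open>\<open>G x\<close> is the colour of the skeleton in front of the point \<open>x\<close>.
  The upper colours \<open>w\<close> are \<open>col (c, Over)\<close> in one application and
  \<open>over_colour\<close> in the other.\<close>

locale clasp_colouring = clasp_module D scale L d + colouring scale L "realization_sign D" w col
  for D and scale :: "laurent \<Rightarrow> 'v :: ab_group_add \<Rightarrow> 'v" (infixr \<open>*s\<close> 75) and L d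
    and w :: "crossing \<Rightarrow> 'v" and col +
  fixes G :: "nat \<Rightarrow> 'v"
  assumes chain_finger: "\<And>x. x < 2 * n \<Longrightarrow> chain (G x) (finger_at D x) (G (Suc x))"
    and G0: "G 0 \<approx> 0"
begin

text \<open>\<open>chain_nest\<close> for a left finger. The shifts \<open>s\<close> are kept
  arbitrary because this is also applied before the upper colours are known explicitly. Where the
  finger is over, its colour depends on its own strand \<open>q\<^sub>0\<close> only.\<close>

lemma left_finger_colours:
  assumes j: "j < n"
    and under: "\<And>i. i < j \<Longrightarrow> passes_over D i j \<Longrightarrow>
      w (FingerCrossing i j Back Back) \<approx> w (FingerCrossing i j Back Out) \<and>
      w (FingerCrossing i j Out Back) \<approx> w (FingerCrossing i j Out Out) \<and>
      (1 - t) *s (w (FingerCrossing i j Back Out) - w (FingerCrossing i j Out Out)) \<approx> s i"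
    and over: "\<And>i. i < j \<Longrightarrow> passes_over D j i \<Longrightarrow> s i = 0"
  shows "\<exists>p p'. chain p (left_tip D j) p' \<and> p \<approx> G (l j) + sum_list (map s (left_partners D j)) \<and>
    G (Suc (l j)) \<approx> G (l j) + (p' - p) \<and>
    (\<forall>i<j. passes_over D j i \<longrightarrow> (\<forall>p\<^sub>0 q\<^sub>0. col (FingerCrossing i j p\<^sub>0 q\<^sub>0, Over) \<approx>
      G (l j) + sum_list (map s (takeWhile (\<lambda>k. k \<noteq> i) (left_partners D j))) + (if q\<^sub>0 = Out then 0 else p' - p)))"
proof -
  interpret F: finger scale L "realization_sign D" w col
    "\<lambda>i. FingerCrossing i j Out Out" "\<lambda>i. FingerCrossing i j Back Out"
    "\<lambda>i. FingerCrossing i j Back Back" "\<lambda>i. FingerCrossing i j Out Back"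
    "finger_level D j" "left_partners D j" by unfold_locales
  have lev: "finger_level D j i = Over \<longleftrightarrow> passes_over D j i" "finger_level D j i = Under \<longleftrightarrow> passes_over D i j"
    "i < j" if "i \<in> set (left_partners D j)" for i
    using that j finger_level_cases[of i j] by (auto simp: set_left_partners)
  have ch: "chain (G (l j)) (left_finger D j) (G (Suc (l j)))"
    using chain_finger[OF l_bound[OF j]] by (simp add: finger_at_l j)
  have "\<exists>p p'. chain p (left_tip D j) p' \<and> p \<approx> G (l j) + sum_list (map s (left_partners D j)) \<and>
    G (Suc (l j)) \<approx> G (l j) + (p' - p) \<and>
    (\<forall>i\<in>set (left_partners D j). finger_level D j i = Over \<longrightarrow>
      (let z = G (l j) + sum_list (map s (takeWhile (\<lambda>k. k \<noteq> i) (left_partners D j))) in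
        col (FingerCrossing i j Out Out, Over) \<approx> z \<and> col (FingerCrossing i j Back Out, Over) \<approx> z \<and>
        col (FingerCrossing i j Back Back, Over) \<approx> z + (p' - p) \<and>
        col (FingerCrossing i j Out Back, Over) \<approx> z + (p' - p)))"
    by (rule F.chain_nest[OF ch[unfolded left_finger_nest] distinct_left_partners])
      (use lev under over passes_over_asym in auto)
  then obtain p p' where p: "chain p (left_tip D j) p'" "p \<approx> G (l j) + sum_list (map s (left_partners D j))"
    "G (Suc (l j)) \<approx> G (l j) + (p' - p)"
    and c: "\<And>i z. i \<in> set (left_partners D j) \<Longrightarrow> finger_level D j i = Over \<Longrightarrow>
      z = G (l j) + sum_list (map s (takeWhile (\<lambda>k. k \<noteq> i) (left_partners D j))) \<Longrightarrow>
        col (FingerCrossing i j Out Out, Over) \<approx> z \<and> col (FingerCrossing i j Back Out, Over) \<approx> z \<and>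
        col (FingerCrossing i j Back Back, Over) \<approx> z + (p' - p) \<and>
        col (FingerCrossing i j Out Back, Over) \<approx> z + (p' - p)"
    unfolding Let_def by blast
  have "col (FingerCrossing i j p\<^sub>0 q\<^sub>0, Over) \<approx>
      G (l j) + sum_list (map s (takeWhile (\<lambda>k. k \<noteq> i) (left_partners D j))) + (if q\<^sub>0 = Out then 0 else p' - p)"
    if i: "i < j" "passes_over D j i" for i p\<^sub>0 q\<^sub>0
  proof -
    have "i \<in> set (left_partners D j)"
      using i passes_over_intersecting by (simp add: set_left_partners)
    then show ?thesis
      using c[of i] i lev(1)[of i] by (cases p\<^sub>0; cases q\<^sub>0) auto
  qed
  with p show ?thesis by blast
qed

lemma right_finger_colours:
  assumes i: "i < n"
    and under: "\<And>j. i < j \<Longrightarrow> j < n \<Longrightarrow> passes_over D j i \<Longrightarrow>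
      w (FingerCrossing i j Back Out) \<approx> w (FingerCrossing i j Out Out) \<and>
      w (FingerCrossing i j Back Back) \<approx> w (FingerCrossing i j Out Back) \<and>
      (1 - t) *s (w (FingerCrossing i j Out Out) - w (FingerCrossing i j Out Back)) \<approx> s j"
    and over: "\<And>j. i < j \<Longrightarrow> j < n \<Longrightarrow> passes_over D i j \<Longrightarrow> s j = 0"
  shows "\<exists>q q'. chain q (right_tip D i) q' \<and> q \<approx> G (r i) + sum_list (map s (right_partners D i)) \<and>
    G (Suc (r i)) \<approx> G (r i) + (q' - q) \<and>
    (\<forall>j. i < j \<and> j < n \<and> passes_over D i j \<longrightarrow> (\<forall>p\<^sub>0 q\<^sub>0. col (FingerCrossing i j p\<^sub>0 q\<^sub>0, Over) \<approx>
      G (r i) + sum_list (map s (takeWhile (\<lambda>k. k \<noteq> j) (right_partners D i))) + (if p\<^sub>0 = Out then 0 else q' - q)))"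
proof -
  interpret F: finger scale L "realization_sign D" w col
    "\<lambda>j. FingerCrossing i j Out Back" "\<lambda>j. FingerCrossing i j Out Out"
    "\<lambda>j. FingerCrossing i j Back Out" "\<lambda>j. FingerCrossing i j Back Back"
    "finger_level D i" "right_partners D i" by unfold_locales
  have lev: "finger_level D i j = Over \<longleftrightarrow> passes_over D i j" "finger_level D i j = Under \<longleftrightarrow> passes_over D j i"
    "i < j" "j < n" if "j \<in> set (right_partners D i)" for j
  proof -
    show *: "i < j" "j < n" using that by (auto simp: set_right_partners)
    have "intersecting D i j" using that by (auto simp: set_right_partners)
    then show "finger_level D i j = Over \<longleftrightarrow> passes_over D i j" "finger_level D i j = Under \<longleftrightarrow> passes_over D j i"
      using finger_level_cases(3,4)[of i j] i * by blast+
  qed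
  have ch: "chain (G (r i)) (right_finger D i) (G (Suc (r i)))"
    using chain_finger[OF r_bound[OF i]] by (simp add: finger_at_r i)
  have "\<exists>p p'. chain p (right_tip D i) p' \<and> p \<approx> G (r i) + sum_list (map s (right_partners D i)) \<and>
    G (Suc (r i)) \<approx> G (r i) + (p' - p) \<and>
    (\<forall>j\<in>set (right_partners D i). finger_level D i j = Over \<longrightarrow>
      (let z = G (r i) + sum_list (map s (takeWhile (\<lambda>k. k \<noteq> j) (right_partners D i))) in
        col (FingerCrossing i j Out Back, Over) \<approx> z \<and> col (FingerCrossing i j Out Out, Over) \<approx> z \<and>
        col (FingerCrossing i j Back Out, Over) \<approx> z + (p' - p) \<and>
        col (FingerCrossing i j Back Back, Over) \<approx> z + (p' - p)))"
    by (rule F.chain_nest[OF ch[unfolded right_finger_nest] distinct_right_partners])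
      (use lev under over passes_over_asym in auto)
  then obtain p p' where p: "chain p (right_tip D i) p'" "p \<approx> G (r i) + sum_list (map s (right_partners D i))"
    "G (Suc (r i)) \<approx> G (r i) + (p' - p)"
    and c: "\<And>j z. j \<in> set (right_partners D i) \<Longrightarrow> finger_level D i j = Over \<Longrightarrow>
      z = G (r i) + sum_list (map s (takeWhile (\<lambda>k. k \<noteq> j) (right_partners D i))) \<Longrightarrow>
        col (FingerCrossing i j Out Back, Over) \<approx> z \<and> col (FingerCrossing i j Out Out, Over) \<approx> z \<and>
        col (FingerCrossing i j Back Out, Over) \<approx> z + (p' - p) \<and>
        col (FingerCrossing i j Back Back, Over) \<approx> z + (p' - p)"
    unfolding Let_def by blast
  have "col (FingerCrossing i j p\<^sub>0 q\<^sub>0, Over) \<approx>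
      G (r i) + sum_list (map s (takeWhile (\<lambda>k. k \<noteq> j) (right_partners D i))) + (if p\<^sub>0 = Out then 0 else p' - p)"
    if j: "i < j" "j < n" "passes_over D i j" for j p\<^sub>0 q\<^sub>0
  proof -
    have "j \<in> set (right_partners D i)"
      using j passes_over_intersecting by (simp add: set_right_partners)
    then show ?thesis
      using c[of j] j lev(1)[of j] by (cases p\<^sub>0; cases q\<^sub>0) auto
  qed
  with p show ?thesis by blast
qed

lemma left_tip_pos:
  assumes "\<epsilon> i = 1" "chain p (left_tip D i) p'"
  shows "col (ClaspCrossing i Upper, Over) \<approx> p" "p' \<approx> t *s p + (1 - t) *s w (ClaspCrossing i Lower)"
proof -
  have *: "chain p [(ClaspCrossing i Upper, Over), (ClaspCrossing i Lower, Under)] p'"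
    using assms by (simp add: left_clasp_level_def del: chain.simps)
  show "col (ClaspCrossing i Upper, Over) \<approx> p"
    by (rule chain_over_under(1)[OF *])
  show "p' \<approx> t *s p + (1 - t) *s w (ClaspCrossing i Lower)"
    using chain_over_under(2)[OF *] assms(1) by (simp add: twist_def)
qed

lemma left_tip_neg:
  assumes "\<epsilon> i = - 1" "chain p (left_tip D i) p'"
  shows "col (ClaspCrossing i Lower, Over) \<approx> p'" "p' \<approx> t_inv *s p + (1 - t_inv) *s w (ClaspCrossing i Upper)"
proof -
  have *: "chain p [(ClaspCrossing i Upper, Under), (ClaspCrossing i Lower, Over)] p'"
    using assms by (simp add: left_clasp_level_def del: chain.simps)
  show "col (ClaspCrossing i Lower, Over) \<approx> p'"
    by (rule chain_under_over(1)[OF *])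
  show "p' \<approx> t_inv *s p + (1 - t_inv) *s w (ClaspCrossing i Upper)"
    using chain_under_over(2)[OF *] assms(1) by (simp add: twist_def)
qed

lemma right_tip_pos:
  assumes "\<epsilon> i = 1" "chain q (right_tip D i) q'"
  shows "col (ClaspCrossing i Lower, Over) \<approx> q" "q' \<approx> t *s q + (1 - t) *s w (ClaspCrossing i Upper)"
proof -
  have *: "chain q [(ClaspCrossing i Lower, Over), (ClaspCrossing i Upper, Under)] q'"
    using assms by (simp add: right_clasp_level_def del: chain.simps)
  show "col (ClaspCrossing i Lower, Over) \<approx> q"
    by (rule chain_over_under(1)[OF *])
  show "q' \<approx> t *s q + (1 - t) *s w (ClaspCrossing i Upper)"
    using chain_over_under(2)[OF *] assms(1) by (simp add: twist_def)
qed

lemma right_tip_neg: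
  assumes "\<epsilon> i = - 1" "chain q (right_tip D i) q'"
  shows "col (ClaspCrossing i Upper, Over) \<approx> q'" "q' \<approx> t_inv *s q + (1 - t_inv) *s w (ClaspCrossing i Lower)"
proof -
  have *: "chain q [(ClaspCrossing i Lower, Under), (ClaspCrossing i Upper, Over)] q'"
    using assms by (simp add: right_clasp_level_def del: chain.simps)
  show "col (ClaspCrossing i Upper, Over) \<approx> q'"
    by (rule chain_under_over(1)[OF *])
  show "q' \<approx> t_inv *s q + (1 - t_inv) *s w (ClaspCrossing i Lower)"
    using chain_under_over(2)[OF *] assms(1) by (simp add: twist_def)
qed

text \<open>In a positive clasp each tip passes under the strand on which the other finger arrives,
  in a negative one under the strand on which it leaves. Either way the two Wirtinger relations
  amount to opposite changes of colour and one further relation.\<close>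

lemma tip_relations:
  assumes i: "i < n" and w: "\<And>u. w (ClaspCrossing i u) = col (ClaspCrossing i u, Over)"
    and p: "chain p (left_tip D i) p'" and q: "chain q (right_tip D i) q'"
  shows "q' - q \<approx> - (p' - p)"
    and "(t_inv - 1) *s (q - p - (p' - p)) - of_int (\<epsilon> i) *s (p' - p) \<approx> 0"
proof -
  have "q' - q \<approx> - (p' - p) \<and> (t_inv - 1) *s (q - p - (p' - p)) - of_int (\<epsilon> i) *s (p' - p) \<approx> 0"
  proof (cases "\<epsilon> i = 1")
    case True
    note tip = left_tip_pos(1)[OF True p, folded w] right_tip_pos(1)[OF True q, folded w]
      left_tip_pos(2)[OF True p] right_tip_pos(2)[OF True q]
    have "p' - p \<approx> t *s p + (1 - t) *s q - p"
      by (rule congr_diff[OF congr_trans[OF tip(3) congr_add[OF congr_refl congr_scale[OF tip(2)]]] congr_refl])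
    also have "\<dots> = (1 - t) *s (q - p)"
      by (simp add: algebra_simps)
    finally have e: "p' - p \<approx> (1 - t) *s (q - p)" .
    have "q' - q \<approx> t *s q + (1 - t) *s p - q"
      by (rule congr_diff[OF congr_trans[OF tip(4) congr_add[OF congr_refl congr_scale[OF tip(1)]]] congr_refl])
    also have "\<dots> = - ((1 - t) *s (q - p))"
      by (simp add: algebra_simps)
    also have "\<dots> \<approx> - (p' - p)"
      by (rule congr_minus[OF congr_sym[OF e]])
    finally have f: "q' - q \<approx> - (p' - p)" .
    have "(t_inv - 1) *s (q - p - (p' - p)) - (p' - p) \<approx>
        (t_inv - 1) *s (q - p - (1 - t) *s (q - p)) - (1 - t) *s (q - p)"
      by (intro congr_diff congr_scale congr_refl e)
    also have "\<dots> = 0"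
      by (simp add: algebra_simps)
    finally show ?thesis using f True by simp
  next
    case False
    then have neg: "\<epsilon> i = - 1" using sign_cases[OF i] by simp
    note tip = left_tip_neg(1)[OF neg p, folded w] right_tip_neg(1)[OF neg q, folded w]
      left_tip_neg(2)[OF neg p] right_tip_neg(2)[OF neg q]
    have h1: "p' - (t_inv *s p + (1 - t_inv) *s q') \<approx> 0"
      using congr_trans[OF tip(3) congr_add[OF congr_refl congr_scale[OF tip(2)]]] congr_0_iff by blast
    have h2: "q' - (t_inv *s q + (1 - t_inv) *s p') \<approx> 0"
      using congr_trans[OF tip(4) congr_add[OF congr_refl congr_scale[OF tip(1)]]] congr_0_iff by blast
    \<comment> \<open>In the sum of the two relations only a multiple by \<open>t_inv\<close> of the
      left-hand side is left.\<close>
    have "(q' - q) - - (p' - p) = t *s ((p' - (t_inv *s p + (1 - t_inv) *s q')) + (q' - (t_inv *s q + (1 - t_inv) *s p')))"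
      by (simp add: algebra_simps)
    then have f: "(q' - q) - - (p' - p) \<approx> 0"
      using congr_0_scale[OF congr_0_add[OF h1 h2], of t] by simp
    have "(t_inv - 1) *s (q - p - (p' - p)) + (p' - p) =
        (p' - (t_inv *s p + (1 - t_inv) *s q')) + (1 - t_inv) *s ((q' - q) - - (p' - p))"
      by (simp add: algebra_simps)
    then have "(t_inv - 1) *s (q - p - (p' - p)) + (p' - p) \<approx> 0"
      using congr_0_add[OF h1 congr_0_scale[OF f, of "1 - t_inv"]] by (simp only:)
    moreover have "q' - q \<approx> - (p' - p)"
      using f congr_0_iff by blast
    moreover have "(t_inv - 1) *s (q - p - (p' - p)) - of_int (\<epsilon> i) *s (p' - p) =
        (t_inv - 1) *s (q - p - (p' - p)) + (p' - p)"
      by (simp add: neg)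
    ultimately show ?thesis by (simp only:)
  qed
  then show "q' - q \<approx> - (p' - p)"
    and "(t_inv - 1) *s (q - p - (p' - p)) - of_int (\<epsilon> i) *s (p' - p) \<approx> 0" by auto
qed

text \<open>If the skeleton and the upper strands have the prescribed colours, so has the finger up
  to its tip. Its overcrossings are treated under the condition \<open>p' - p \<approx> d j\<close>,
  which comes from the choice of \<open>d\<close> in one application and from the clasp relation in
  the other.\<close>

lemma explicit_left:
  assumes j: "j < n" and Gl: "G (l j) \<approx> base (l j)"
    and w: "\<And>i. i < j \<Longrightarrow> passes_over D i j \<Longrightarrow>
      w (FingerCrossing i j Out Back) \<approx> w (FingerCrossing i j Out Out) \<and>
      w (FingerCrossing i j Back Back) \<approx> w (FingerCrossing i j Back Out) \<and>
      w (FingerCrossing i j Back Out) - w (FingerCrossing i j Out Out) \<approx> - d i"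
  shows "\<exists>p p'. chain p (left_tip D j) p' \<and> p \<approx> left_colour j \<and> G (Suc (l j)) \<approx> G (l j) + (p' - p) \<and>
    (p' - p \<approx> d j \<longrightarrow>
      (\<forall>i<j. passes_over D j i \<longrightarrow> (\<forall>p\<^sub>0 q\<^sub>0. col (FingerCrossing i j p\<^sub>0 q\<^sub>0, Over) \<approx>
        over_colour (FingerCrossing i j p\<^sub>0 q\<^sub>0))))"
proof -
  have under: "(1 - t) *s (w (FingerCrossing i j Back Out) - w (FingerCrossing i j Out Out)) \<approx> shift j i"
    if "i < j" "passes_over D i j" for i
  proof -
    have "(1 - t) *s (w (FingerCrossing i j Back Out) - w (FingerCrossing i j Out Out)) \<approx> (1 - t) *s (- d i)"
      using w[OF that] congr_scale by blast
    also have "\<dots> = shift j i"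
      using that j passes_over_intersecting[OF that(2)] finger_level_cases(2)[of i j]
      by (simp add: shift_def algebra_simps)
    finally show ?thesis .
  qed
  have over: "shift j i = 0" if "i < j" "passes_over D j i" for i
    using that j passes_over_intersecting[OF that(2)] finger_level_cases(1)[of i j]
    by (simp add: shift_def)
  obtain p p' where p: "chain p (left_tip D j) p'" "p \<approx> G (l j) + sum_list (map (shift j) (left_partners D j))"
    "G (Suc (l j)) \<approx> G (l j) + (p' - p)"
    and c: "\<And>i p\<^sub>0 q\<^sub>0. i < j \<Longrightarrow> passes_over D j i \<Longrightarrow> col (FingerCrossing i j p\<^sub>0 q\<^sub>0, Over) \<approx>
      G (l j) + sum_list (map (shift j) (takeWhile (\<lambda>k. k \<noteq> i) (left_partners D j))) + (if q\<^sub>0 = Out then 0 else p' - p)"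
    using left_finger_colours[OF j, of "shift j"] w under over by blast
  have "p \<approx> left_colour j"
    using congr_trans[OF p(2) congr_add[OF Gl congr_refl]] by (simp add: left_colour_def)
  moreover have "col (FingerCrossing i j p\<^sub>0 q\<^sub>0, Over) \<approx> over_colour (FingerCrossing i j p\<^sub>0 q\<^sub>0)"
    if d: "p' - p \<approx> d j" and i: "i < j" "passes_over D j i" for i p\<^sub>0 q\<^sub>0
  proof -
    have "(if q\<^sub>0 = Out then 0 else p' - p) \<approx> (if q\<^sub>0 = Out then 0 else d j)"
      using d by simp
    then show ?thesis
      using congr_trans[OF c[OF i] congr_add[OF congr_add[OF Gl congr_refl]]] passes_over_asym[OF i(2)] by simp
  qed
  ultimately show ?thesis using p by blast
qed

lemma explicit_right:
  assumes i: "i < n" and Gr: "G (r i) \<approx> base (r i)"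
    and w: "\<And>j. i < j \<Longrightarrow> j < n \<Longrightarrow> passes_over D j i \<Longrightarrow>
      w (FingerCrossing i j Back Out) \<approx> w (FingerCrossing i j Out Out) \<and>
      w (FingerCrossing i j Back Back) \<approx> w (FingerCrossing i j Out Back) \<and>
      w (FingerCrossing i j Out Back) - w (FingerCrossing i j Out Out) \<approx> d j"
  shows "\<exists>q q'. chain q (right_tip D i) q' \<and> q \<approx> right_colour i \<and> G (Suc (r i)) \<approx> G (r i) + (q' - q) \<and>
    (q' - q \<approx> - d i \<longrightarrow>
      (\<forall>j. i < j \<and> j < n \<and> passes_over D i j \<longrightarrow> (\<forall>p\<^sub>0 q\<^sub>0. col (FingerCrossing i j p\<^sub>0 q\<^sub>0, Over) \<approx>
        over_colour (FingerCrossing i j p\<^sub>0 q\<^sub>0))))"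
proof -
  have under: "(1 - t) *s (w (FingerCrossing i j Out Out) - w (FingerCrossing i j Out Back)) \<approx> shift i j"
    if "i < j" "j < n" "passes_over D j i" for j
  proof -
    have "(1 - t) *s (w (FingerCrossing i j Out Out) - w (FingerCrossing i j Out Back)) =
        (t - 1) *s (w (FingerCrossing i j Out Back) - w (FingerCrossing i j Out Out))"
      by (simp add: algebra_simps)
    also have "\<dots> \<approx> (t - 1) *s d j"
      using w[OF that] congr_scale by blast
    also have "\<dots> = shift i j"
      using that i passes_over_intersecting[OF that(3)] finger_level_cases(2)[of j i]
      by (simp add: shift_def)
    finally show ?thesis .
  qed
  have over: "shift i j = 0" if "i < j" "j < n" "passes_over D i j" for j
    using that i passes_over_intersecting[OF that(3)] finger_level_cases(3)[of i j]
    by (simp add: shift_def)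
  obtain q q' where q: "chain q (right_tip D i) q'" "q \<approx> G (r i) + sum_list (map (shift i) (right_partners D i))"
    "G (Suc (r i)) \<approx> G (r i) + (q' - q)"
    and c: "\<And>j p\<^sub>0 q\<^sub>0. i < j \<Longrightarrow> j < n \<Longrightarrow> passes_over D i j \<Longrightarrow> col (FingerCrossing i j p\<^sub>0 q\<^sub>0, Over) \<approx>
      G (r i) + sum_list (map (shift i) (takeWhile (\<lambda>k. k \<noteq> j) (right_partners D i))) + (if p\<^sub>0 = Out then 0 else q' - q)"
    using right_finger_colours[OF i, of "shift i"] w under over by blast
  have "q \<approx> right_colour i"
    using congr_trans[OF q(2) congr_add[OF Gr congr_refl]] by (simp add: right_colour_def)
  moreover have "col (FingerCrossing i j p\<^sub>0 q\<^sub>0, Over) \<approx> over_colour (FingerCrossing i j p\<^sub>0 q\<^sub>0)"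
    if d: "q' - q \<approx> - d i" and j: "i < j" "j < n" "passes_over D i j" for j p\<^sub>0 q\<^sub>0
  proof -
    have "(if p\<^sub>0 = Out then 0 else q' - q) \<approx> (if p\<^sub>0 = Out then 0 else - d i)"
      using d by simp
    then show ?thesis
      using congr_trans[OF c[OF j] congr_add[OF congr_add[OF Gr congr_refl]]] j by simp
  qed
  ultimately show ?thesis using q by blast
qed

text \<open>Induction along the skeleton. The premises may use the colour in front of the finger,
  which is what \<open>explicit_left\<close> and \<open>explicit_right\<close> require.\<close>

lemma skeleton_colours:
  assumes "\<And>i. i < n \<Longrightarrow> l i < m \<Longrightarrow> G (l i) \<approx> base (l i) \<Longrightarrow> G (Suc (l i)) \<approx> G (l i) + d i"
    and "\<And>i. i < n \<Longrightarrow> r i < m \<Longrightarrow> G (r i) \<approx> base (r i) \<Longrightarrow> G (Suc (r i)) \<approx> G (r i) - d i"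
    and "x \<le> m" "m \<le> 2 * n"
  shows "G x \<approx> base x"
  using assms(3)
proof (induction x)
  case 0
  then show ?case using G0 by (simp add: base_0)
next
  case (Suc x)
  then have IH: "G x \<approx> base x" and x: "x < 2 * n" using assms(4) by auto
  show ?case
  proof (cases rule: end_cases[OF x])
    case (1 i)
    have "G (Suc (l i)) \<approx> G (l i) + d i"
      using assms(1)[of i] 1 IH Suc.prems by simp
    then show ?thesis
      using congr_trans[OF _ congr_add[OF IH congr_refl]] 1 by (simp add: base_Suc_l)
  next
    case (2 i)
    have "G (Suc (r i)) \<approx> G (r i) - d i"
      using assms(2)[of i] 2 IH Suc.prems by simp
    then show ?thesis
      using congr_trans[OF _ congr_diff[OF IH congr_refl]] 2 by (simp add: base_Suc_r)
  qed
qed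

end

section \<open>Colourings and the clasp relations\<close>

context clasp_colouring
begin

text \<open>Supplies the hypothesis on upper strands for a right finger passing under this left
  finger: both of its strands meet the same colours. Relying on \<open>chain_nest_over\<close>, it
  avoids a circular argument between the fingers.\<close>

lemma left_finger_pairs:
  assumes "i < j" "j < n" "passes_over D j i"
  shows "col (FingerCrossing i j Out Out, Over) \<approx> col (FingerCrossing i j Back Out, Over)"
    "col (FingerCrossing i j Back Back, Over) \<approx> col (FingerCrossing i j Out Back, Over)"
proof -
  interpret F: finger scale L "realization_sign D" w col
    "\<lambda>i. FingerCrossing i j Out Out" "\<lambda>i. FingerCrossing i j Back Out"
    "\<lambda>i. FingerCrossing i j Back Back" "\<lambda>i. FingerCrossing i j Out Back"
    "finger_level D j" "left_partners D j" by unfold_locales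
  have ch: "chain (G (l j)) (left_finger D j) (G (Suc (l j)))"
    using chain_finger[OF l_bound] assms(2) by (simp add: finger_at_l)
  have "i \<in> set (left_partners D j)" "finger_level D j i = Over"
    using assms passes_over_intersecting[OF assms(3)] by (simp_all add: set_left_partners finger_level_def)
  from F.chain_nest_over[OF ch[unfolded left_finger_nest] this]
  show "col (FingerCrossing i j Out Out, Over) \<approx> col (FingerCrossing i j Back Out, Over)"
    "col (FingerCrossing i j Back Back, Over) \<approx> col (FingerCrossing i j Out Back, Over)"
    by blast+
qed

lemma right_finger_pairs:
  assumes "i < j" "j < n" "passes_over D i j"
  shows "col (FingerCrossing i j Out Back, Over) \<approx> col (FingerCrossing i j Out Out, Over)"
    "col (FingerCrossing i j Back Out, Over) \<approx> col (FingerCrossing i j Back Back, Over)"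
proof -
  interpret F: finger scale L "realization_sign D" w col
    "\<lambda>j. FingerCrossing i j Out Back" "\<lambda>j. FingerCrossing i j Out Out"
    "\<lambda>j. FingerCrossing i j Back Out" "\<lambda>j. FingerCrossing i j Back Back"
    "finger_level D i" "right_partners D i" by unfold_locales
  have i: "i < n" using assms by simp
  have ch: "chain (G (r i)) (right_finger D i) (G (Suc (r i)))"
    using chain_finger[OF r_bound[OF i]] by (simp add: finger_at_r i)
  have "j \<in> set (right_partners D i)" "finger_level D i j = Over"
    using assms passes_over_intersecting[OF assms(3)] by (simp_all add: set_right_partners finger_level_def)
  from F.chain_nest_over[OF ch[unfolded right_finger_nest] this]
  show "col (FingerCrossing i j Out Back, Over) \<approx> col (FingerCrossing i j Out Out, Over)"
    "col (FingerCrossing i j Back Out, Over) \<approx> col (FingerCrossing i j Back Back, Over)"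
    by blast+
qed

lemma congr_diff_same: "x \<approx> z \<Longrightarrow> y \<approx> z + e \<Longrightarrow> y - x \<approx> e"
  using congr_diff[of y "z + e" x z] by simp

lemma clasp_over_colours:
  assumes i: "i < n" and p: "chain p (left_tip D i) p'" "p \<approx> left_colour i" "p' - p \<approx> d i"
    and q: "chain q (right_tip D i) q'" "q \<approx> right_colour i" "q' - q \<approx> - d i"
  shows "col (ClaspCrossing i u, Over) \<approx> over_colour (ClaspCrossing i u)"
proof (cases "\<epsilon> i = 1")
  case True
  then show ?thesis
    using congr_trans[OF left_tip_pos(1)[OF True p(1)] p(2)] congr_trans[OF right_tip_pos(1)[OF True q(1)] q(2)]
    by (cases u) simp_all
next
  case False
  then have neg: "\<epsilon> i = - 1" using sign_cases[OF i] by simp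
  have "p' \<approx> left_colour i + d i" "q' \<approx> right_colour i - d i"
    using congr_add[OF p(2,3)] congr_add[OF q(2,3)] by simp_all
  then show ?thesis
    using congr_trans[OF left_tip_neg(1)[OF neg p(1)]] congr_trans[OF right_tip_neg(1)[OF neg q(1)]] False
    by (cases u) simp_all
qed

lemma all_over_colours:
  assumes L: "\<And>j. j < n \<Longrightarrow> \<exists>p p'. chain p (left_tip D j) p' \<and> p \<approx> left_colour j \<and> p' - p \<approx> d j \<and>
      (\<forall>i<j. passes_over D j i \<longrightarrow> (\<forall>p\<^sub>0 q\<^sub>0. col (FingerCrossing i j p\<^sub>0 q\<^sub>0, Over) \<approx>
        over_colour (FingerCrossing i j p\<^sub>0 q\<^sub>0)))"
    and R: "\<And>i. i < n \<Longrightarrow> \<exists>q q'. chain q (right_tip D i) q' \<and> q \<approx> right_colour i \<and> q' - q \<approx> - d i \<and>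
      (\<forall>j. i < j \<and> j < n \<and> passes_over D i j \<longrightarrow> (\<forall>p\<^sub>0 q\<^sub>0. col (FingerCrossing i j p\<^sub>0 q\<^sub>0, Over) \<approx>
        over_colour (FingerCrossing i j p\<^sub>0 q\<^sub>0)))"
    and c: "c \<in> crossings"
  shows "col (c, Over) \<approx> over_colour c"
proof -
  consider i j p\<^sub>0 q\<^sub>0 where "c = FingerCrossing i j p\<^sub>0 q\<^sub>0" "i < j" "j < n" "intersecting D i j"
    | i u where "c = ClaspCrossing i u" "i < n"
    using c by (auto simp: crossings_def)
  then show ?thesis
  proof cases
    case (1 i j)
    then have i: "i < n" by simp
    show ?thesis
      using L[OF 1(3)] R[OF i] passes_over_iff[OF i 1(3,4)] 1 by blast
  next
    case (2 i)
    show ?thesis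
      using L[OF 2(2)] R[OF 2(2)] clasp_over_colours[OF 2(2)] 2(1) by blast
  qed
qed

text \<open>The order matters: first the differences are constant along each finger, then the clasps
  make them opposite, which determines the skeleton; this gives the explicit colours of all fingers,
  and finally the relation left over at each clasp.\<close>

lemma knot_relations:
  assumes w: "\<And>c. w c = col (c, Over)"
    and d: "\<And>i. i < n \<Longrightarrow> d i = G (Suc (l i)) - G (l i)"
  shows "\<And>i. i < n \<Longrightarrow> relation i \<approx> 0"
    and "\<And>c. c \<in> crossings \<Longrightarrow> col (c, Over) \<approx> over_colour c"
proof -
  have left: "\<exists>p p'. chain p (left_tip D j) p' \<and> p' - p \<approx> d j \<and> (\<forall>i<j. passes_over D j i \<longrightarrow>
      w (FingerCrossing i j Out Back) - w (FingerCrossing i j Out Out) \<approx> d j)" if j: "j < n" for j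
  proof -
    \<comment> \<open>The colours of the upper strands are not yet known, so the actual shifts are
      taken.\<close>
    define s where "s i = (if passes_over D i j
      then (1 - t) *s (w (FingerCrossing i j Back Out) - w (FingerCrossing i j Out Out)) else 0)" for i
    have under: "w (FingerCrossing i j Back Back) \<approx> w (FingerCrossing i j Back Out) \<and>
        w (FingerCrossing i j Out Back) \<approx> w (FingerCrossing i j Out Out) \<and>
        (1 - t) *s (w (FingerCrossing i j Back Out) - w (FingerCrossing i j Out Out)) \<approx> s i"
      if "i < j" "passes_over D i j" for i
      using right_finger_pairs[OF that(1) j that(2)] that by (simp add: w s_def congr_sym)
    have over: "s i = 0" if "i < j" "passes_over D j i" for i
      using passes_over_asym[OF that(2)] by (simp add: s_def)
    obtain p p' where p: "chain p (left_tip D j) p'" "G (Suc (l j)) \<approx> G (l j) + (p' - p)"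
      and c: "\<And>i p\<^sub>0 q\<^sub>0. i < j \<Longrightarrow> passes_over D j i \<Longrightarrow> col (FingerCrossing i j p\<^sub>0 q\<^sub>0, Over) \<approx>
        G (l j) + sum_list (map s (takeWhile (\<lambda>k. k \<noteq> i) (left_partners D j))) + (if q\<^sub>0 = Out then 0 else p' - p)"
      using left_finger_colours[OF j under over] by blast
    have dj: "p' - p \<approx> d j"
      using p(2) d[OF j] congr_diff_iff congr_sym by metis
    have "w (FingerCrossing i j Out Back) - w (FingerCrossing i j Out Out) \<approx> d j"
      if "i < j" "passes_over D j i" for i
      using congr_trans[OF congr_diff_same dj] c[OF that, of Out Out] c[OF that, of Out Back] by (simp add: w)
    with p(1) dj show ?thesis by blast
  qed
  have right: "\<exists>q q'. chain q (right_tip D i) q' \<and> G (Suc (r i)) \<approx> G (r i) + (q' - q) \<and>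
      (\<forall>j. i < j \<and> j < n \<and> passes_over D i j \<longrightarrow>
      w (FingerCrossing i j Back Out) - w (FingerCrossing i j Out Out) \<approx> q' - q)" if i: "i < n" for i
  proof -
    define s where "s j = (if passes_over D j i
      then (1 - t) *s (w (FingerCrossing i j Out Out) - w (FingerCrossing i j Out Back)) else 0)" for j
    have under: "w (FingerCrossing i j Back Out) \<approx> w (FingerCrossing i j Out Out) \<and>
        w (FingerCrossing i j Back Back) \<approx> w (FingerCrossing i j Out Back) \<and>
        (1 - t) *s (w (FingerCrossing i j Out Out) - w (FingerCrossing i j Out Back)) \<approx> s j"
      if "i < j" "j < n" "passes_over D j i" for j
      using left_finger_pairs[OF that] that by (simp add: w s_def congr_sym)
    have over: "s j = 0" if "i < j" "j < n" "passes_over D i j" for j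
      using passes_over_asym[OF that(3)] by (simp add: s_def)
    obtain q q' where q: "chain q (right_tip D i) q'" "G (Suc (r i)) \<approx> G (r i) + (q' - q)"
      and c: "\<And>j p\<^sub>0 q\<^sub>0. i < j \<Longrightarrow> j < n \<Longrightarrow> passes_over D i j \<Longrightarrow> col (FingerCrossing i j p\<^sub>0 q\<^sub>0, Over) \<approx>
        G (r i) + sum_list (map s (takeWhile (\<lambda>k. k \<noteq> j) (right_partners D i))) + (if p\<^sub>0 = Out then 0 else q' - q)"
      using right_finger_colours[OF i under over] by blast
    have "w (FingerCrossing i j Back Out) - w (FingerCrossing i j Out Out) \<approx> q' - q"
      if "i < j" "j < n" "passes_over D i j" for j
      using congr_diff_same c[OF that, of Out Out] c[OF that, of Back Out] by (simp add: w)
    with q show ?thesis by blast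
  qed
  \<comment> \<open>The clasp carries the difference \<open>d i\<close> over from the left finger to
    the right one, with opposite sign.\<close>
  have opposite: "q' - q \<approx> - d i"
    if i: "i < n" and q: "chain q (right_tip D i) q'" for i q q'
  proof -
    obtain p p' where p: "chain p (left_tip D i) p'" "p' - p \<approx> d i" using left[OF i] by blast
    show ?thesis
      by (rule congr_trans[OF tip_relations(1)[OF i w p(1) q] congr_minus[OF p(2)]])
  qed
  have Gr: "G (Suc (r i)) \<approx> G (r i) - d i" if i: "i < n" for i
  proof -
    obtain q q' where q: "chain q (right_tip D i) q'" "G (Suc (r i)) \<approx> G (r i) + (q' - q)"
      using right[OF i] by blast
    show ?thesis
      using congr_trans[OF q(2) congr_add[OF congr_refl opposite[OF i q(1)]]] by simp
  qed
  have Gl: "G (Suc (l i)) \<approx> G (l i) + d i" if "i < n" for i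
    by (simp add: d that)
  have G: "G x \<approx> base x" if "x \<le> 2 * n" for x
    by (rule skeleton_colours[OF _ _ that order_refl]) (simp_all add: Gl Gr)
  have wl: "w (FingerCrossing i j Out Back) \<approx> w (FingerCrossing i j Out Out) \<and>
      w (FingerCrossing i j Back Back) \<approx> w (FingerCrossing i j Back Out) \<and>
      w (FingerCrossing i j Back Out) - w (FingerCrossing i j Out Out) \<approx> - d i"
    if ij: "i < j" "j < n" "passes_over D i j" for i j
  proof -
    have i: "i < n" using ij by simp
    obtain q q' where q: "chain q (right_tip D i) q'"
      "w (FingerCrossing i j Back Out) - w (FingerCrossing i j Out Out) \<approx> q' - q"
      using right[OF i] ij by blast
    show ?thesis
      using right_finger_pairs[OF ij] congr_trans[OF q(2) opposite[OF i q(1)]] by (simp add: w congr_sym)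
  qed
  have wr: "w (FingerCrossing i j Back Out) \<approx> w (FingerCrossing i j Out Out) \<and>
      w (FingerCrossing i j Back Back) \<approx> w (FingerCrossing i j Out Back) \<and>
      w (FingerCrossing i j Out Back) - w (FingerCrossing i j Out Out) \<approx> d j"
    if ij: "i < j" "j < n" "passes_over D j i" for i j
    using left_finger_pairs[OF ij] left[OF ij(2)] ij by (auto simp: w congr_sym)
  have L: "\<exists>p p'. chain p (left_tip D j) p' \<and> p \<approx> left_colour j \<and> p' - p \<approx> d j \<and>
      (\<forall>i<j. passes_over D j i \<longrightarrow> (\<forall>p\<^sub>0 q\<^sub>0. col (FingerCrossing i j p\<^sub>0 q\<^sub>0, Over) \<approx>
        over_colour (FingerCrossing i j p\<^sub>0 q\<^sub>0)))" if j: "j < n" for j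
  proof -
    obtain p p' where p: "chain p (left_tip D j) p'" "p \<approx> left_colour j" "G (Suc (l j)) \<approx> G (l j) + (p' - p)"
      and c: "p' - p \<approx> d j \<Longrightarrow>
      (\<forall>i<j. passes_over D j i \<longrightarrow> (\<forall>p\<^sub>0 q\<^sub>0. col (FingerCrossing i j p\<^sub>0 q\<^sub>0, Over) \<approx>
        over_colour (FingerCrossing i j p\<^sub>0 q\<^sub>0)))"
      using explicit_left[OF j G[OF less_imp_le[OF l_bound[OF j]]] wl[OF _ j]] by blast
    have "p' - p \<approx> d j"
      using p(3) d[OF j] congr_diff_iff congr_sym by metis
    with p c show ?thesis by blast
  qed
  have R: "\<exists>q q'. chain q (right_tip D i) q' \<and> q \<approx> right_colour i \<and> q' - q \<approx> - d i \<and>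
      (\<forall>j. i < j \<and> j < n \<and> passes_over D i j \<longrightarrow> (\<forall>p\<^sub>0 q\<^sub>0. col (FingerCrossing i j p\<^sub>0 q\<^sub>0, Over) \<approx>
        over_colour (FingerCrossing i j p\<^sub>0 q\<^sub>0)))" if i: "i < n" for i
    using explicit_right[OF i G[OF less_imp_le[OF r_bound[OF i]]] wr] opposite[OF i] by blast
  show "relation i \<approx> 0" if i: "i < n" for i
  proof -
    obtain p p' where p: "chain p (left_tip D i) p'" "p \<approx> left_colour i" "p' - p \<approx> d i"
      using L[OF i] by blast
    obtain q q' where q: "chain q (right_tip D i) q'" "q \<approx> right_colour i"
      using R[OF i] by blast
    \<comment> \<open>The clasp relation holds for the actual colours at the tips, which are
      congruent to the explicit ones.\<close>
    have "relation i \<approx> (t_inv - 1) *s (q - p - (p' - p)) - of_int (\<epsilon> i) *s (p' - p)"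
      unfolding relation_eq[OF i]
      by (intro congr_diff congr_scale congr_sym[OF q(2)] congr_sym[OF p(2)] congr_sym[OF p(3)])
    then show ?thesis
      using tip_relations(2)[OF i w p(1) q(1)] congr_trans by blast
  qed
  show "col (c, Over) \<approx> over_colour c" if "c \<in> crossings" for c
    by (rule all_over_colours[OF L R that])
qed

text \<open>The converse: with prescribed upper colours, the clasp relations force the tips to
  change colour by \<open>d i\<close> and \<open>- d i\<close>, so that the colours found along the
  knot reproduce the prescription.\<close>

lemma explicit_colours:
  assumes w: "\<And>c. c \<in> crossings \<Longrightarrow> w c = over_colour c"
    and rel: "\<And>i. i < n \<Longrightarrow> relation i \<approx> 0"
  shows "\<And>x. x \<le> 2 * n \<Longrightarrow> G x \<approx> base x"
    and "\<And>c. c \<in> crossings \<Longrightarrow> col (c, Over) \<approx> over_colour c"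
proof -
  have wf: "w (FingerCrossing i j p\<^sub>0 q\<^sub>0) = over_colour (FingerCrossing i j p\<^sub>0 q\<^sub>0)"
    if "i < j" "j < n" "passes_over D i j \<or> passes_over D j i" for i j p\<^sub>0 q\<^sub>0
    using that passes_over_intersecting by (intro w) (auto simp: crossings_def)
  have wc: "w (ClaspCrossing i u) = over_colour (ClaspCrossing i u)" if "i < n" for i u
    using that by (intro w) (auto simp: crossings_def)
  have wl: "w (FingerCrossing i j Out Back) \<approx> w (FingerCrossing i j Out Out) \<and>
      w (FingerCrossing i j Back Back) \<approx> w (FingerCrossing i j Back Out) \<and>
      w (FingerCrossing i j Back Out) - w (FingerCrossing i j Out Out) \<approx> - d i"
    if "i < j" "j < n" "passes_over D i j" for i j
    using that by (simp add: wf)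
  have wr: "w (FingerCrossing i j Back Out) \<approx> w (FingerCrossing i j Out Out) \<and>
      w (FingerCrossing i j Back Back) \<approx> w (FingerCrossing i j Out Back) \<and>
      w (FingerCrossing i j Out Back) - w (FingerCrossing i j Out Out) \<approx> d j"
    if "i < j" "j < n" "passes_over D j i" for i j
    using that passes_over_asym[OF that(3)] by (simp add: wf)
  have pos: "(t_inv - 1) *s (right_colour i - left_colour i - d i) - d i \<approx> 0" if "i < n" "\<epsilon> i = 1" for i
    using rel[OF that(1)] relation_eq[OF that(1)] that(2) by simp
  have neg: "(t_inv - 1) *s (right_colour i - left_colour i - d i) + d i \<approx> 0" if "i < n" "\<epsilon> i = - 1" for i
    using rel[OF that(1)] relation_eq[OF that(1)] that(2) by simp
  have tip_l: "p' - p \<approx> d i" if i: "i < n" and p: "chain p (left_tip D i) p'" "p \<approx> left_colour i" for i p p'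
  proof (cases "\<epsilon> i = 1")
    case True
    have "p' - p \<approx> t *s left_colour i + (1 - t) *s right_colour i - left_colour i"
      using congr_diff[OF congr_trans[OF left_tip_pos(2)[OF True p(1)] congr_add[OF congr_scale[OF p(2)] congr_refl]] p(2)]
        wc[OF i] True by simp
    \<comment> \<open>The defect is a unit multiple of the clasp relation; the other three cases
      differ in the unit.\<close>
    moreover have "t *s left_colour i + (1 - t) *s right_colour i - left_colour i - d i =
        t *s ((t_inv - 1) *s (right_colour i - left_colour i - d i) - d i)"
      by (simp add: algebra_simps)
    then have "t *s left_colour i + (1 - t) *s right_colour i - left_colour i \<approx> d i"
      using congr_0_scale[OF pos[OF i True], of t] congr_0_iff by metis
    ultimately show ?thesis by (rule congr_trans)
  next
    case False
    then have e: "\<epsilon> i = - 1" using sign_cases[OF i] by simp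
    have "p' - p \<approx> t_inv *s left_colour i + (1 - t_inv) *s (right_colour i - d i) - left_colour i"
      using congr_diff[OF congr_trans[OF left_tip_neg(2)[OF e p(1)] congr_add[OF congr_scale[OF p(2)] congr_refl]] p(2)]
        wc[OF i] e by simp
    moreover have "t_inv *s left_colour i + (1 - t_inv) *s (right_colour i - d i) - left_colour i - d i =
        (- 1) *s ((t_inv - 1) *s (right_colour i - left_colour i - d i) + d i)"
      by (simp add: algebra_simps)
    then have "t_inv *s left_colour i + (1 - t_inv) *s (right_colour i - d i) - left_colour i \<approx> d i"
      using congr_0_scale[OF neg[OF i e], of "- 1"] congr_0_iff by metis
    ultimately show ?thesis by (rule congr_trans)
  qed
  have tip_r: "q' - q \<approx> - d i" if i: "i < n" and q: "chain q (right_tip D i) q'" "q \<approx> right_colour i" for i q q'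
  proof (cases "\<epsilon> i = 1")
    case True
    have "q' - q \<approx> t *s right_colour i + (1 - t) *s left_colour i - right_colour i"
      using congr_diff[OF congr_trans[OF right_tip_pos(2)[OF True q(1)] congr_add[OF congr_scale[OF q(2)] congr_refl]] q(2)]
        wc[OF i] True by simp
    moreover have "t *s right_colour i + (1 - t) *s left_colour i - right_colour i - - d i =
        (- t) *s ((t_inv - 1) *s (right_colour i - left_colour i - d i) - d i)"
      by (simp add: algebra_simps)
    then have "t *s right_colour i + (1 - t) *s left_colour i - right_colour i \<approx> - d i"
      using congr_0_scale[OF pos[OF i True], of "- t"] congr_0_iff by metis
    ultimately show ?thesis by (rule congr_trans)
  next
    case False
    then have e: "\<epsilon> i = - 1" using sign_cases[OF i] by simp
    have "q' - q \<approx> t_inv *s right_colour i + (1 - t_inv) *s (left_colour i + d i) - right_colour i"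
      using congr_diff[OF congr_trans[OF right_tip_neg(2)[OF e q(1)] congr_add[OF congr_scale[OF q(2)] congr_refl]] q(2)]
        wc[OF i] e by simp
    moreover have "t_inv *s right_colour i + (1 - t_inv) *s (left_colour i + d i) - right_colour i - - d i =
        1 *s ((t_inv - 1) *s (right_colour i - left_colour i - d i) + d i)"
      by (simp add: algebra_simps)
    then have "t_inv *s right_colour i + (1 - t_inv) *s (left_colour i + d i) - right_colour i \<approx> - d i"
      using congr_0_scale[OF neg[OF i e], of 1] congr_0_iff by metis
    ultimately show ?thesis by (rule congr_trans)
  qed
  show G: "G x \<approx> base x" if "x \<le> 2 * n" for x
  proof (rule skeleton_colours[OF _ _ that order_refl])
    fix i assume i: "i < n" "G (l i) \<approx> base (l i)"
    then obtain p p' where "chain p (left_tip D i) p'" "p \<approx> left_colour i" "G (Suc (l i)) \<approx> G (l i) + (p' - p)"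
      using explicit_left[OF i wl[OF _ i(1)]] by blast
    then show "G (Suc (l i)) \<approx> G (l i) + d i"
      using congr_trans[OF _ congr_add[OF congr_refl tip_l[OF i(1)]]] by blast
  next
    fix i assume i: "i < n" "G (r i) \<approx> base (r i)"
    then obtain q q' where "chain q (right_tip D i) q'" "q \<approx> right_colour i" "G (Suc (r i)) \<approx> G (r i) + (q' - q)"
      using explicit_right[OF i wr] by blast
    then have "G (Suc (r i)) \<approx> G (r i) + - d i"
      using congr_trans[OF _ congr_add[OF congr_refl tip_r[OF i(1)]]] by blast
    then show "G (Suc (r i)) \<approx> G (r i) - d i" by simp
  qed
  have L: "\<exists>p p'. chain p (left_tip D j) p' \<and> p \<approx> left_colour j \<and> p' - p \<approx> d j \<and>
      (\<forall>i<j. passes_over D j i \<longrightarrow> (\<forall>p\<^sub>0 q\<^sub>0. col (FingerCrossing i j p\<^sub>0 q\<^sub>0, Over) \<approx>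
        over_colour (FingerCrossing i j p\<^sub>0 q\<^sub>0)))" if j: "j < n" for j
    using explicit_left[OF j G[OF less_imp_le[OF l_bound[OF j]]] wl[OF _ j]] tip_l[OF j] by blast
  have R: "\<exists>q q'. chain q (right_tip D i) q' \<and> q \<approx> right_colour i \<and> q' - q \<approx> - d i \<and>
      (\<forall>j. i < j \<and> j < n \<and> passes_over D i j \<longrightarrow> (\<forall>p\<^sub>0 q\<^sub>0. col (FingerCrossing i j p\<^sub>0 q\<^sub>0, Over) \<approx>
        over_colour (FingerCrossing i j p\<^sub>0 q\<^sub>0)))" if i: "i < n" for i
    using explicit_right[OF i G[OF less_imp_le[OF r_bound[OF i]]] wr] tip_r[OF i] by blast
  show "col (c, Over) \<approx> over_colour c" if "c \<in> crossings" for c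
    by (rule all_over_colours[OF L R that])
qed

end

section \<open>From colourings to the Alexander matrix\<close>

text \<open>The three arcs at an undercrossing may coincide, so their Fox coefficients are added up
  by indicators instead of being separated into cases.\<close>

lemma alexander_matrix_entry:
  assumes "a < length (undercrossings K)" "g < num_arcs K"
  shows "alexander_matrix K $$ (a, g) =
    (let u = twist (crossing_sign K (undercrossings K ! a))
     in (1 - u) * of_bool (over_arc K (undercrossings K ! a) = g) + u * of_bool (a = g)
       - of_bool (Suc a mod num_arcs K = g))"
  using assms
  by (simp add: alexander_matrix_def wirtinger_relator_def twist_def Let_def algebra_simps)

text \<open>Applied to a colouring, a row of the Alexander matrix is the defect of a Wirtinger
  relation.\<close>

lemma alexander_matrix_mult:
  assumes "a < length (undercrossings K)"
  shows "(\<Sum>g<num_arcs K. alexander_matrix K $$ (a, g) * F g) =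
    (let u = twist (crossing_sign K (undercrossings K ! a))
     in (1 - u) * F (over_arc K (undercrossings K ! a)) + u * F a - F (Suc a mod num_arcs K))"
proof -
  have pick: "(\<Sum>g<num_arcs K. c * of_bool (h = g) * F g) = c * F h" if "h < num_arcs K" for c h
  proof -
    have "(\<Sum>g<num_arcs K. c * of_bool (h = g) * F g) = (\<Sum>g<num_arcs K. if g = h then c * F h else 0)"
      by (rule sum.cong) auto
    then show ?thesis using that by simp
  qed
  have "num_arcs K > 0" by (simp add: num_arcs_def)
  then have "over_arc K c < num_arcs K" "Suc a mod num_arcs K < num_arcs K" "a < num_arcs K" for c
    using assms by (auto simp: over_arc_def num_arcs_def)
  note lt = this
  define u h s where "u = twist (crossing_sign K (undercrossings K ! a))"
    and "h = over_arc K (undercrossings K ! a)" and "s = Suc a mod num_arcs K"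
  have "(\<Sum>g<num_arcs K. alexander_matrix K $$ (a, g) * F g) =
      (\<Sum>g<num_arcs K. (1 - u) * of_bool (h = g) * F g) + (\<Sum>g<num_arcs K. u * of_bool (a = g) * F g)
      - (\<Sum>g<num_arcs K. 1 * of_bool (s = g) * F g)"
    unfolding sum.distrib [symmetric] sum_subtractf [symmetric]
    by (rule sum.cong)
      (simp_all add: alexander_matrix_entry assms Let_def u_def h_def s_def left_diff_distrib distrib_right)
  also have "\<dots> = (1 - u) * F h + u * F a - 1 * F s"
    unfolding h_def s_def by (simp only: pick[OF lt(1)] pick[OF lt(2)] pick[OF lt(3)])
  finally show ?thesis by (simp add: Let_def u_def h_def s_def)
qed

section \<open>Row spans as submodules\<close>

abbreviation vec_scale :: "laurent \<Rightarrow> (nat \<Rightarrow> laurent) \<Rightarrow> nat \<Rightarrow> laurent" where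
  "vec_scale c v \<equiv> (\<lambda>k. c * v k)"

lemma module_vec_scale: "Modules.module vec_scale"
  by unfold_locales (simp_all add: fun_eq_iff algebra_simps)

text \<open>Vectors are functions on all naturals of which only the first \<open>m\<close>
  coordinates count; membership then yields the coefficients of a matrix product.\<close>

definition row_span :: "nat \<Rightarrow> nat \<Rightarrow> (nat \<Rightarrow> nat \<Rightarrow> laurent) \<Rightarrow> (nat \<Rightarrow> laurent) set" where
  "row_span p m R = {v. \<exists>x. \<forall>k<m. v k = (\<Sum>j<p. x j * R j k)}"

lemma quotient_module_row_span: "quotient_module vec_scale (row_span p m R)"
proof -
  interpret Modules.module vec_scale by (rule module_vec_scale)
  show ?thesis
  proof (unfold_locales, rule subspaceI)
    show "0 \<in> row_span p m R"
      unfolding row_span_def by (auto intro!: exI[of _ "\<lambda>_. 0"])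
    show "v + v' \<in> row_span p m R" if v: "v \<in> row_span p m R" "v' \<in> row_span p m R" for v v'
    proof -
      obtain x x' where "\<forall>k<m. v k = (\<Sum>j<p. x j * R j k)" "\<forall>k<m. v' k = (\<Sum>j<p. x' j * R j k)"
        using v unfolding row_span_def by blast
      then show ?thesis
        unfolding row_span_def
        by (auto intro!: exI[of _ "\<lambda>j. x j + x' j"] simp: distrib_right sum.distrib)
    qed
    show "vec_scale c v \<in> row_span p m R" if v: "v \<in> row_span p m R" for c v
    proof -
      obtain x where "\<forall>k<m. v k = (\<Sum>j<p. x j * R j k)"
        using v unfolding row_span_def by blast
      then show ?thesis
        unfolding row_span_def
        by (auto intro!: exI[of _ "\<lambda>j. c * x j"] simp: sum_distrib_left mult.assoc)
    qed
  qed
qed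

lemma row_in_row_span: "j < p \<Longrightarrow> (\<And>k. k < m \<Longrightarrow> v k = R j k) \<Longrightarrow> v \<in> row_span p m R"
  unfolding row_span_def
  by (auto intro!: exI[of _ "\<lambda>i. of_bool (i = j)"] simp: of_bool_def if_distrib[where f = "\<lambda>c. c * _"] cong: if_cong)

section \<open>Arcs of the realization, cut at the base point\<close>

context clasp
begin

abbreviation K where "K \<equiv> realization D"
abbreviation N where "N \<equiv> length (undercrossings K)"

text \<open>The arc on which the skeleton runs in front of the point \<open>x\<close>.\<close>

definition skeleton_arc :: "nat \<Rightarrow> nat" where
  "skeleton_arc x = length (filter (\<lambda>p. snd p = Under) (concat (map (finger_at D) [0..<x])))"

lemma skeleton_arc_0: "skeleton_arc 0 = 0"
  by (simp add: skeleton_arc_def)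

lemma skeleton_arc_end: "skeleton_arc (2 * n) = N"
  by (simp add: skeleton_arc_def undercrossings_def realization_def)

lemma code_split:
  assumes "x < 2 * n"
  shows "gauss_code K = concat (map (finger_at D) [0..<x]) @ finger_at D x @
    concat (map (finger_at D) [Suc x..<2 * n])"
proof -
  have "[0..<2 * n] = [0..<x] @ x # [Suc x..<2 * n]"
    using upt_add_eq_append[of 0 x "2 * n - x"] upt_conv_Cons[OF assms] assms by simp
  then show ?thesis by (simp add: realization_def)
qed

lemma skeleton_arc_le: "x \<le> 2 * n \<Longrightarrow> skeleton_arc x \<le> N"
proof (cases "x = 2 * n")
  case False
  moreover assume "x \<le> 2 * n"
  ultimately have "x < 2 * n" by simp
  then show ?thesis
    by (simp add: skeleton_arc_def undercrossings_def code_split)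
qed (simp add: skeleton_arc_end)

lemma arc_before_le: "arc_before (gauss_code K) e \<le> N"
proof -
  have "filter (\<lambda>p. snd p = Under) (gauss_code K) =
      filter (\<lambda>p. snd p = Under) (takeWhile (\<lambda>p. p \<noteq> e) (gauss_code K)) @
      filter (\<lambda>p. snd p = Under) (dropWhile (\<lambda>p. p \<noteq> e) (gauss_code K))"
    by (metis filter_append takeWhile_dropWhile_id)
  then show ?thesis by (simp add: arc_before_def undercrossings_def)
qed

text \<open>At its clasp the left finger of the chord 0 passes under once. Hence the number of arcs
  is \<open>N\<close> as soon as there is a chord.\<close>

lemma N_pos: "n > 0 \<Longrightarrow> N > 0"
proof -
  assume n: "n > 0"
  define u where "u = (if \<epsilon> 0 = 1 then Lower else Upper)"
  have "(ClaspCrossing 0 u, Under) \<in> set (left_tip D 0)"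
    by (auto simp: left_clasp_level_def u_def)
  then have "(ClaspCrossing 0 u, Under) \<in> set (finger_at D (l 0))"
    using n by (simp only: finger_at_l left_finger_nest set_nest) blast
  then have "ClaspCrossing 0 u \<in> set (undercrossings K)"
    using l_bound[OF n] unfolding undercrossings_def realization_def by force
  then show ?thesis by (cases "undercrossings K") auto
qed

end

text \<open>Cutting the Gauss code into fingers reduces the chain conditions to one relation per
  undercrossing. The arcs are those of the long knot, so the arcs 0 and \<open>N\<close> may have
  different colours.\<close>

lemma (in clasp_module) clasp_colouring_of_arcs:
  assumes f0: "f 0 \<approx> 0"
    and f: "\<And>a. a < N \<Longrightarrow> f (Suc a) \<approx> twist (realization_sign D (undercrossings K ! a)) *s f a +
      (1 - twist (realization_sign D (undercrossings K ! a))) *s w (undercrossings K ! a)"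
  shows "clasp_colouring D scale L w (\<lambda>e. f (arc_before (gauss_code K) e)) (\<lambda>x. f (skeleton_arc x))"
proof -
  interpret colouring scale L "realization_sign D" w "\<lambda>e. f (arc_before (gauss_code K) e)" by unfold_locales
  show ?thesis
  proof unfold_locales
    show "f (skeleton_arc 0) \<approx> 0" using f0 by (simp add: skeleton_arc_0)
    fix x assume x: "x < 2 * n"
    let ?xs = "concat (map (finger_at D) [0..<x])" and ?zs = "concat (map (finger_at D) [Suc x..<2 * n])"
    let ?U = "filter (\<lambda>p. snd p = Under)"
    have und: "undercrossings K = map fst (?U (?xs @ finger_at D x)) @ map fst (?U ?zs)"
      by (simp add: undercrossings_def code_split[OF x])
    have "chain (f (length (?U ?xs))) (finger_at D x) (f (length (?U (?xs @ finger_at D x))))"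
    proof (rule chain_of_arcs[where zs = ?zs and c = "\<lambda>a. undercrossings K ! a"])
      show "distinct (?xs @ finger_at D x @ ?zs)"
        using distinct_code unfolding code_split[OF x] .
      fix a assume a: "a < length (?U (?xs @ finger_at D x))"
      then show "undercrossings K ! a = fst (?U (?xs @ finger_at D x) ! a)"
        unfolding und by (subst nth_append) (simp del: filter_append)
      have "a < N" using a unfolding und by simp
      then show "f (Suc a) \<approx> twist (realization_sign D (undercrossings K ! a)) *s f a +
          (1 - twist (realization_sign D (undercrossings K ! a))) *s w (undercrossings K ! a)"
        by (rule f)
    qed (simp add: code_split[OF x])
    then show "chain (f (skeleton_arc x)) (finger_at D x) (f (skeleton_arc (Suc x)))"
      by (simp add: skeleton_arc_def)
  qed
qed

text \<open>The explicit colours are combinations of the differences; this will show that the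
  differences generate all arcs modulo the relations.\<close>

lemma (in clasp_module) over_colour_in_subspace:
  assumes T: "subspace T" and d: "\<And>i. i < n \<Longrightarrow> d i \<in> T" and c: "c \<in> crossings"
  shows "over_colour c \<in> T"
proof -
  note [intro] = subspace_add[OF T] subspace_diff[OF T] subspace_scale[OF T] subspace_0[OF T] subspace_neg[OF T] d
  have base: "base x \<in> T" for x
    unfolding base_def by (rule subspace_sum[OF T]) auto
  have sums: "sum_list (map (shift i) ks) \<in> T" if "set ks \<subseteq> {..<n}" for i ks
    using that by (induction ks) (auto simp: shift_def)
  have lp: "set (left_partners D j) \<subseteq> {..<n}" if "j < n" for j
    using that by (auto simp: set_left_partners)
  have rp: "set (right_partners D i) \<subseteq> {..<n}" for i
    by (auto simp: set_right_partners)
  have lc: "left_colour i \<in> T" if "i < n" for i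
    unfolding left_colour_def using base sums lp[OF that] by blast
  have rc: "right_colour i \<in> T" for i
    unfolding right_colour_def using base sums rp by blast
  consider i j p\<^sub>0 q\<^sub>0 where "c = FingerCrossing i j p\<^sub>0 q\<^sub>0" "i < j" "j < n" "intersecting D i j"
    | i u where "c = ClaspCrossing i u" "i < n"
    using c by (auto simp: crossings_def)
  then show ?thesis
  proof cases
    case (1 i j)
    then have "d i \<in> T" "d j \<in> T" using d by auto
    moreover have "sum_list (map (shift i) (takeWhile (\<lambda>k. k \<noteq> j) (right_partners D i))) \<in> T"
      using set_takeWhileD rp by (intro sums) fast
    moreover have "sum_list (map (shift j) (takeWhile (\<lambda>k. k \<noteq> i) (left_partners D j))) \<in> T"
      using set_takeWhileD lp[OF 1(3)] by (intro sums) fast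
    ultimately show ?thesis using 1 base by auto
  next
    case (2 i u)
    then show ?thesis using lc rc by (cases u) auto
  qed
qed

lemma sum_fun_apply: "(\<Sum>i\<in>I. f i) k = (\<Sum>i\<in>I. f i k)"
  by (induction I rule: infinite_finite_induct) simp_all

text \<open>The set is the sum of the submodules \<open>M\<close> and \<open>L\<close>.\<close>

lemma (in quotient_module) subspace_congr:
  assumes M: "subspace M" shows "subspace {v. \<exists>x\<in>M. v \<approx> x}"
proof (rule subspaceI)
  show "0 \<in> {v. \<exists>x\<in>M. v \<approx> x}" using subspace_0[OF M] by blast
  show "v + v' \<in> {v. \<exists>x\<in>M. v \<approx> x}" if "v \<in> {v. \<exists>x\<in>M. v \<approx> x}" "v' \<in> {v. \<exists>x\<in>M. v \<approx> x}" for v v'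
    using that congr_add subspace_add[OF M] by blast
  show "c *s v \<in> {v. \<exists>x\<in>M. v \<approx> x}" if "v \<in> {v. \<exists>x\<in>M. v \<approx> x}" for c v
    using that congr_scale subspace_scale[OF M] by blast
qed

lemma crossing_sign_realization: "crossing_sign (realization D) = realization_sign D"
  by (simp add: realization_def)

lemma bounded_choice: "(\<And>k. k < m \<Longrightarrow> \<exists>x. P k x) \<Longrightarrow> \<exists>X. \<forall>k<m. P k (X k)" for m :: nat
  by metis

lemma bounded_choice2: "(\<And>k. k < m \<Longrightarrow> \<exists>x y. P k x y) \<Longrightarrow> \<exists>X Y. \<forall>k<m. P k (X k) (Y k)" for m :: nat
  by metis

lemma minors_0: "minors 0 (A :: 'a :: comm_ring_1 mat) = {1}"
proof -
  have det: "det (submatrix A {} {}) = 1"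
    by (rule det_dim_zero) (simp add: submatrix_def)
  have empty: "I = {}" if "I \<subseteq> {..<m}" "card I = 0" for I and m :: nat
    using that finite_subset[OF that(1)] by simp
  show ?thesis
  proof (intro equalityI subsetI)
    fix m assume "m \<in> minors 0 A"
    then obtain I J where "m = det (submatrix A I J)" "I = {}" "J = {}"
      unfolding minors_def using empty by blast
    then show "m \<in> {1}" using det by simp
  next
    fix m :: 'a assume "m \<in> {1}"
    then show "m \<in> minors 0 A"
      unfolding minors_def using det by (intro CollectI exI[of _ "{}"]) simp
  qed
qed

section \<open>The two divisibilities\<close>

context clasp
begin

lemma dvd_det_clasp_matrix:
  assumes n: "n > 0" and q: "\<And>m. m \<in> minors (N - 1) (alexander_matrix K) \<Longrightarrow> q dvd m"
  shows "q dvd det (clasp_matrix D)"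
proof -
  have N: "N > 0" by (rule N_pos[OF n])
  then have arcs: "num_arcs K = N" unfolding num_arcs_def by linarith
  define u where "u a = twist (realization_sign D (undercrossings K ! a))" for a
  \<comment> \<open>The arc 0 gets the colour 0, and the arc \<open>g > 0\<close> of the long knot
    the basis vector number \<open>g - 1\<close>; with arcs up to \<open>N\<close>, the relation
    matrix becomes square.\<close>
  define e where "e g = (\<lambda>k. of_bool (g = Suc k) :: laurent)" for g :: nat
  define w where "w c = e (arc_before (gauss_code K) (c, Over))" for c
  define R where "R a = e (Suc a) - (vec_scale (u a) (e a) + vec_scale (1 - u a) (w (undercrossings K ! a)))" for a
  define d where "d i = e (skeleton_arc (Suc (l i))) - e (skeleton_arc (l i))" for i
  let ?L = "row_span N N R"
  interpret Q: quotient_module vec_scale ?L by (rule quotient_module_row_span)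
  interpret V: clasp_module D vec_scale ?L d by unfold_locales
  have "clasp_colouring D vec_scale ?L w (\<lambda>p. e (arc_before (gauss_code K) p)) (\<lambda>x. e (skeleton_arc x))"
  proof (rule V.clasp_colouring_of_arcs)
    show "Q.congr (e 0) 0" by (simp add: e_def zero_fun_def)
    fix a assume "a < N"
    then have "R a \<in> ?L" by (rule row_in_row_span) simp
    then show "Q.congr (e (Suc a)) (vec_scale (twist (realization_sign D (undercrossings K ! a))) (e a) +
        vec_scale (1 - twist (realization_sign D (undercrossings K ! a))) (w (undercrossings K ! a)))"
      by (simp add: Q.congr_def R_def u_def)
  qed
  then interpret C: clasp_colouring D vec_scale ?L d w "\<lambda>p. e (arc_before (gauss_code K) p)" "\<lambda>x. e (skeleton_arc x)" .
  have rel: "V.relation i \<in> ?L" if "i < n" for i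
    using C.knot_relations(1)[OF w_def d_def that] by (simp add: Q.congr_def)
  have over: "w c - V.over_colour c \<in> ?L" if "c \<in> crossings" for c
    using C.knot_relations(2)[OF w_def d_def that] by (simp add: Q.congr_def w_def)
  interpret Qd: quotient_module vec_scale "row_span n N d" by (rule quotient_module_row_span)
  \<comment> \<open>The differences together with the relations; an induction along the arcs will
    show that all colours lie in this submodule.\<close>
  let ?T = "{v. \<exists>x \<in> row_span n N d. Q.congr v x}"
  have T: "Q.subspace ?T" by (rule Q.subspace_congr[OF Qd.L])
  have LT: "v \<in> ?T" if "v \<in> ?L" for v
    using that Q.subspace_0[OF Qd.L] by (auto simp: Q.congr_def intro!: bexI[of _ 0])
  have dT: "d i \<in> ?T" if "i < n" for i
    using row_in_row_span[OF that, of N "d i" d] by blast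
  have wT: "w c \<in> ?T" if "c \<in> crossings" for c
    using Q.subspace_add[OF T LT[OF over[OF that]] V.over_colour_in_subspace[OF T dT that]] by simp
  have eT: "e g \<in> ?T" if "g \<le> N" for g
    using that
  proof (induction g)
    case 0
    have "e 0 = 0" by (simp add: e_def zero_fun_def)
    then show ?case using Q.subspace_0[OF T] by (simp only:)
  next
    case (Suc a)
    then have a: "a < N" "e a \<in> ?T" by auto
    have "undercrossings K ! a \<in> crossings" using undercrossings_subset a(1) by auto
    note sum = Q.subspace_add[OF T Q.subspace_scale[OF T a(2), of "u a"] Q.subspace_scale[OF T wT[OF this], of "1 - u a"]]
    have "R a \<in> ?T" by (rule LT, rule row_in_row_span[OF a(1)]) simp
    moreover have "R a + (vec_scale (u a) (e a) + vec_scale (1 - u a) (w (undercrossings K ! a))) = e (Suc a)"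
      by (simp add: R_def)
    ultimately show ?case using Q.subspace_add[OF T _ sum] by (metis (no_types, lifting))
  qed
  \<comment> \<open>\<open>B\<close> expresses the arcs by the differences, and \<open>X\<close>
    collects the multiples of the relations used for this.\<close>
  have "\<exists>B X. \<forall>k<N. \<forall>k'<N. e (Suc k) k' = (\<Sum>i<n. B k i * d i k') + (\<Sum>a<N. X k a * R a k')"
  proof (rule bounded_choice2)
    fix k assume "k < N"
    then have "e (Suc k) \<in> ?T" by (intro eT) simp
    then obtain v where v: "v \<in> row_span n N d" "e (Suc k) - v \<in> ?L" by (auto simp: Q.congr_def)
    obtain b where b: "\<forall>k'<N. v k' = (\<Sum>i<n. b i * d i k')"
      using v(1) unfolding row_span_def by blast
    obtain x where x: "\<forall>k'<N. (e (Suc k) - v) k' = (\<Sum>a<N. x a * R a k')"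
      using v(2) unfolding row_span_def by blast
    have "e (Suc k) k' = (\<Sum>i<n. b i * d i k') + (\<Sum>a<N. x a * R a k')" if "k' < N" for k'
    proof -
      have "e (Suc k) k' = v k' + (e (Suc k) - v) k'" by simp
      then show ?thesis using b x that by (simp only:)
    qed
    then show "\<exists>b x. \<forall>k'<N. e (Suc k) k' = (\<Sum>i<n. b i * d i k') + (\<Sum>a<N. x a * R a k')"
      by blast
  qed
  then obtain B X where BX: "\<And>k k'. k < N \<Longrightarrow> k' < N \<Longrightarrow>
      e (Suc k) k' = (\<Sum>i<n. B k i * d i k') + (\<Sum>a<N. X k a * R a k')"
    by blast
  have "\<exists>Y. \<forall>i<n. \<forall>k<N. V.relation i k = (\<Sum>a<N. Y i a * R a k)"
    by (rule bounded_choice) (use rel in \<open>simp add: row_span_def\<close>)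
  then obtain Y where Y: "\<And>i k. i < n \<Longrightarrow> k < N \<Longrightarrow> V.relation i k = (\<Sum>a<N. Y i a * R a k)"
    by blast
  \<comment> \<open>\<open>relation\<close> is built from the columns of the clasp matrix, hence the
    transposition.\<close>
  let ?S = "transpose_mat (clasp_matrix D)"
  \<comment> \<open>The sign makes the entries agree with those of the Alexander matrix;
    \<open>?X\<close> and \<open>?Y\<close> compensate for it.\<close>
  let ?A = "mat N N (\<lambda>(a, k). - R a k)"
  let ?B = "mat N n (\<lambda>(k, i). B k i)" and ?\<Delta> = "mat n N (\<lambda>(i, k). d i k)"
  let ?X = "mat N N (\<lambda>(k, a). - X k a)" and ?Y = "mat n N (\<lambda>(i, a). - Y i a)"
  have S: "clasp_matrix D \<in> carrier_mat n n" by (simp add: clasp_matrix_def)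
  have XA: "?X * ?A = 1\<^sub>m N - ?B * ?\<Delta>"
  proof (rule eq_matI)
    fix k k' assume "k < dim_row (1\<^sub>m N - ?B * ?\<Delta>)" "k' < dim_col (1\<^sub>m N - ?B * ?\<Delta>)"
    then have k: "k < N" "k' < N" by auto
    have "(\<Sum>a<N. X k a * R a k') = of_bool (k = k') - (\<Sum>i<n. B k i * d i k')"
      using BX[OF k] by (simp add: e_def)
    then show "(?X * ?A) $$ (k, k') = (1\<^sub>m N - ?B * ?\<Delta>) $$ (k, k')"
      using k by (simp add: scalar_prod_def atLeast0LessThan)
  qed auto
  have YA: "?Y * ?A = ?S * ?\<Delta>"
  proof (rule eq_matI)
    fix i k assume "i < dim_row (?S * ?\<Delta>)" "k < dim_col (?S * ?\<Delta>)"
    then have ik: "i < n" "k < N" using S by auto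
    have "(\<Sum>a<N. Y i a * R a k) = (\<Sum>m<n. clasp_matrix D $$ (m, i) * d m k)"
      using Y[OF ik] by (simp add: V.relation_def sum_fun_apply)
    then show "(?Y * ?A) $$ (i, k) = (?S * ?\<Delta>) $$ (i, k)"
      using ik S by (simp add: scalar_prod_def atLeast0LessThan)
  qed (use S in auto)
  have "det ?A dvd det ?S"
    by (rule det_dvd_of_presentation[OF _ _ _ _ _ _ XA YA]) (use S in auto)
  moreover have "q dvd det ?A"
  proof (rule dvd_det_of_dvd_minors[where A = "alexander_matrix K" and N = N])
    fix a k assume a: "a < N" and k: "k < N - 1"
    \<comment> \<open>Closing the knot identifies only the arc \<open>N\<close> with the arc 0, and
      neither belongs to the columns \<open>k < N - 1\<close> compared here.\<close>
    have "arc_before (gauss_code K) p mod N = Suc k \<longleftrightarrow> arc_before (gauss_code K) p = Suc k" for p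
      using arc_before_le[of p] k by (cases "arc_before (gauss_code K) p = N") auto
    moreover have "Suc a mod N = Suc k \<longleftrightarrow> Suc a = Suc k"
      using a k by (cases "Suc a = N") auto
    ultimately show "?A $$ (a, k) = alexander_matrix K $$ (a, Suc k)"
      using a k by (simp add: alexander_matrix_entry arcs Let_def R_def w_def e_def u_def over_arc_def
          arc_before_def [symmetric] crossing_sign_realization)
  qed (use q N arcs in \<open>auto simp: alexander_matrix_def\<close>)
  ultimately show ?thesis using det_transpose[OF S] by (metis dvd_trans)
qed

lemma det_clasp_matrix_dvd:
  assumes n: "n > 0" and m: "m \<in> minors (N - 1) (alexander_matrix K)"
  shows "det (clasp_matrix D) dvd m"
proof -
  have N: "N > 0" by (rule N_pos[OF n])
  then have arcs: "num_arcs K = N" unfolding num_arcs_def by linarith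
  define u where "u a = twist (realization_sign D (undercrossings K ! a))" for a
  define d where "d i = (\<lambda>k. of_bool (i = k) :: laurent)" for i :: nat
  let ?S = "transpose_mat (clasp_matrix D)"
  have S: "clasp_matrix D \<in> carrier_mat n n" by (simp add: clasp_matrix_def)
  let ?L = "row_span n n (\<lambda>j k. ?S $$ (j, k))"
  interpret Q: quotient_module vec_scale ?L by (rule quotient_module_row_span)
  interpret V: clasp_module D vec_scale ?L d by unfold_locales
  \<comment> \<open>The arcs are coloured one after another, starting with 0 and using the
    prescribed upper colours. That these agree with the colours of the upper arcs will hold modulo
    the clasp relations.\<close>
  define B where "B = rec_nat 0 (\<lambda>a b. vec_scale (u a) b + vec_scale (1 - u a) (V.over_colour (undercrossings K ! a)))"
  have B0: "B 0 = 0" by (simp add: B_def)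
  have BS: "B (Suc a) = vec_scale (u a) (B a) + vec_scale (1 - u a) (V.over_colour (undercrossings K ! a))" for a
    by (simp add: B_def)
  have "clasp_colouring D vec_scale ?L V.over_colour (\<lambda>p. B (arc_before (gauss_code K) p)) (\<lambda>x. B (skeleton_arc x))"
    by (rule V.clasp_colouring_of_arcs) (simp_all only: B0 BS u_def Q.congr_refl)
  then interpret C: clasp_colouring D vec_scale ?L d V.over_colour
    "\<lambda>p. B (arc_before (gauss_code K) p)" "\<lambda>x. B (skeleton_arc x)" .
  have rel: "Q.congr (V.relation j) 0" if j: "j < n" for j
  proof -
    have "V.relation j k = ?S $$ (j, k)" if "k < n" for k
      using j that S by (simp add: V.relation_def sum_fun_apply d_def of_bool_def if_distrib cong: if_cong)
    then show ?thesis
      using row_in_row_span[OF j, of n "V.relation j"] by (simp add: Q.congr_def)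
  qed
  have G: "Q.congr (B (skeleton_arc x)) (V.base x)" if "x \<le> 2 * n" for x
    by (rule C.explicit_colours(1)[OF refl rel that])
  have over: "Q.congr (B (arc_before (gauss_code K) (c, Over))) (V.over_colour c)" if "c \<in> crossings" for c
    by (rule C.explicit_colours(2)[OF refl rel that])
  \<comment> \<open>The colouring closes up at the base point, so arc numbers may be reduced modulo
    \<open>N\<close>.\<close>
  have "Q.congr (B N) 0"
    using G[of "2 * n"] by (simp add: skeleton_arc_end V.base_end)
  then have mod: "Q.congr (B (g mod N)) (B g)" if "g \<le> N" for g
    using that Q.congr_sym by (cases "g = N") (auto simp: B0)
  have rows: "(\<lambda>k. \<Sum>g<N. alexander_matrix K $$ (a, g) * B g k) \<in> ?L" if a: "a < N" for a
  proof -
    let ?c = "undercrossings K ! a"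
    have c: "?c \<in> crossings" using undercrossings_subset a by auto
    have "Q.congr (vec_scale (1 - u a) (B (over_arc K ?c)) + vec_scale (u a) (B a) - B (Suc a mod N))
        (vec_scale (1 - u a) (V.over_colour ?c) + vec_scale (u a) (B a) - B (Suc a))"
    proof (intro Q.congr_add Q.congr_diff Q.congr_scale Q.congr_refl)
      show "Q.congr (B (over_arc K ?c)) (V.over_colour ?c)"
        using Q.congr_trans[OF mod[OF arc_before_le] over[OF c]]
        by (simp add: over_arc_def arc_before_def arcs)
      show "Q.congr (B (Suc a mod N)) (B (Suc a))" using a by (intro mod) simp
    qed
    moreover have "(\<lambda>k. \<Sum>g<N. alexander_matrix K $$ (a, g) * B g k) =
        vec_scale (1 - u a) (B (over_arc K ?c)) + vec_scale (u a) (B a) - B (Suc a mod N)"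
      (is "?lhs = ?rhs")
    proof
      fix k
      show "?lhs k = ?rhs k"
        using alexander_matrix_mult[OF a, of "\<lambda>g. B g k"]
        by (simp add: arcs Let_def u_def crossing_sign_realization)
    qed
    moreover have "vec_scale (1 - u a) (V.over_colour ?c) + vec_scale (u a) (B a) - B (Suc a) = 0"
      by (simp add: BS add.commute)
    ultimately show ?thesis by (simp only: Q.congr_def diff_zero)
  qed
  \<comment> \<open>The arc behind the left finger of the chord \<open>i\<close> minus the one in
    front of it: a combination with coefficient sum 0 whose colour is the basis vector
    \<open>d i\<close>.\<close>
  define \<Delta> where "\<Delta> i g = of_bool (skeleton_arc (Suc (l i)) mod N = g) - (of_bool (skeleton_arc (l i) mod N = g) :: laurent)"
    for i g
  have pick: "(\<Sum>g<N. of_bool (h mod N = g) * F g) = F (h mod N)" for h and F :: "nat \<Rightarrow> laurent"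
    using N by (simp add: of_bool_def if_distrib[where f = "\<lambda>c. c * _"] cong: if_cong)
  have \<Delta>: "(\<lambda>k. (\<Sum>g<N. \<Delta> i g * B g k) - of_bool (i = k)) \<in> ?L" if i: "i < n" for i
  proof -
    have lt: "Suc (l i) \<le> 2 * n" using l_bound[OF i] by simp
    have "Q.congr (B (skeleton_arc (Suc (l i)) mod N) - B (skeleton_arc (l i) mod N)) (V.base (Suc (l i)) - V.base (l i))"
      using lt by (intro Q.congr_diff Q.congr_trans[OF mod G] skeleton_arc_le) auto
    then show ?thesis
      by (simp add: Q.congr_def V.base_Suc_l[OF i] \<Delta>_def left_diff_distrib sum_subtractf pick d_def fun_diff_def)
  qed
  have "\<exists>X. \<forall>a<N. \<forall>k<n. (\<Sum>g<N. alexander_matrix K $$ (a, g) * B g k) = (\<Sum>j<n. X a j * ?S $$ (j, k))"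
    by (rule bounded_choice) (use rows in \<open>simp add: row_span_def\<close>)
  then obtain X where X: "\<And>a k. a < N \<Longrightarrow> k < n \<Longrightarrow>
      (\<Sum>g<N. alexander_matrix K $$ (a, g) * B g k) = (\<Sum>j<n. X a j * ?S $$ (j, k))"
    by blast
  have "\<exists>Y. \<forall>i<n. \<forall>k<n. (\<Sum>g<N. \<Delta> i g * B g k) - of_bool (i = k) = (\<Sum>j<n. Y i j * ?S $$ (j, k))"
    by (rule bounded_choice) (use \<Delta> in \<open>simp add: row_span_def\<close>)
  then obtain Y where Y: "\<And>i k. i < n \<Longrightarrow> k < n \<Longrightarrow>
      (\<Sum>g<N. \<Delta> i g * B g k) - of_bool (i = k) = (\<Sum>j<n. Y i j * ?S $$ (j, k))"
    by blast
  have "det ?S dvd m"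
  proof (rule det_dvd_minors[where A = "alexander_matrix K" and N = N and n = n and B = B and C = X and \<Delta> = \<Delta> and K = Y])
    show "alexander_matrix K \<in> carrier_mat N N" by (simp add: alexander_matrix_def arcs)
    show "(\<Sum>g<N. alexander_matrix K $$ (a, g)) = 0" if "a < N" for a
      using alexander_matrix_mult[OF that, of "\<lambda>_. 1"] by (simp add: arcs Let_def)
    show "(\<Sum>g<N. \<Delta> i g) = 0" for i
      using pick[of _ "\<lambda>_. 1"] by (simp add: \<Delta>_def sum_subtractf)
    show "(\<Sum>g<N. \<Delta> i g * B g k) = (if i = k then 1 else 0) + (\<Sum>j<n. Y i j * ?S $$ (j, k))"
      if "i < n" "k < n" for i k
      using Y[OF that] by (auto simp: algebra_simps)
  qed (use X N S m in auto)
  then show ?thesis using det_transpose[OF S] by simp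
qed

end

theorem proposition4:
  fixes D :: clasp_diagram and \<Delta> :: laurent
  assumes "long_clasp_diagram D"
  shows "is_alexander_polynomial (realization D) \<Delta> \<longleftrightarrow> \<Delta> \<doteq> det (clasp_matrix D)"
proof -
  interpret clasp D by unfold_locales (rule assms)
  let ?E = "minors (num_arcs K - 1) (alexander_matrix K)"
  have "(\<forall>m\<in>?E. det (clasp_matrix D) dvd m) \<and> (\<forall>q. (\<forall>m\<in>?E. q dvd m) \<longrightarrow> q dvd det (clasp_matrix D))"
  \<comment> \<open>Without chords there is a single arc and no undercrossing, so the only minor is
    the empty determinant.\<close>
  proof (cases "n = 0")
    case True
    have und: "undercrossings K = []" by (simp add: undercrossings_def realization_def True)
    then have "?E = {1}" by (simp add: num_arcs_def minors_0)
    moreover have "det (clasp_matrix D) = 1"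
      by (rule det_dim_zero) (simp add: clasp_matrix_def True)
    ultimately show ?thesis by simp
  next
    case False
    then have "num_arcs K = N" using N_pos unfolding num_arcs_def by linarith
    then show ?thesis using False dvd_det_clasp_matrix det_clasp_matrix_dvd by auto
  qed
  then have dvd: "\<And>m. m \<in> ?E \<Longrightarrow> det (clasp_matrix D) dvd m"
    and gcd: "\<And>q. (\<And>m. m \<in> ?E \<Longrightarrow> q dvd m) \<Longrightarrow> q dvd det (clasp_matrix D)" by blast+
  \<comment> \<open>The determinant is a greatest common divisor of the minors, and such divisors
    are unique up to associates.\<close>
  show ?thesis
    unfolding is_alexander_polynomial_def Let_def laurent_equiv_iff_dvd
  proof (intro iffI conjI)
    assume "\<Delta> dvd det (clasp_matrix D) \<and> det (clasp_matrix D) dvd \<Delta>"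
    then show "\<forall>m\<in>?E. \<Delta> dvd m" "\<forall>q. (\<forall>m\<in>?E. q dvd m) \<longrightarrow> q dvd \<Delta>"
      using dvd gcd dvd_trans by blast+
  qed (use dvd gcd in blast)+
qed

end
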